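(* Let $C$ be any non-degenerate conic (ellipse, parabola or hyperbola), different from a circle, in the field of constructible numbers. Then every conic-constructible point of $\mathbb{C}$ is $C$-constructible.
   Context: Identify $\mathbb{R}^2$ with $\mathbb{C}$ via $(x,y)\leftrightarrow x+iy$. For a set $P\subset\mathbb{C}$ consider the drawings: (i) given two points of $P$, draw the line through them; (ii) given two points $z_1,z_2\in P$, draw the circle centered at $z_1$ with radius $|z_1-z_2|$; (iii) draw all parabolas, ellipses and hyperbolas having foci in $P$, directrix lines which are obtained from (i), and eccentricities equal to the length $|z_1-z_2|$ of a segment for some $z_1,z_2\in P$. Constructible points: put $P_0=\{0,1\}$ and let $P_{k+1}$ be $P_k$ together with all the intersection points of the lines and circles drawn from $P_k$ by (i), (ii). A point is constructible if it lies in $\bigcup_{k\ge 0}P_k$. The constructible numbers are the $x$-coordinates of constructible points; they form a subfield of $\mathbb{R}$. Conic-constructible points: put $Q_0=\{0,1\}$ and let $Q_{k+1}$ be $Q_k$ together with all the intersection points of the lines, circles and conics drawn from $Q_k$ by (i), (ii), (iii). A point is conic-constructible if it lies in $\bigcup_{k\ge 0}Q_k$. Conic in a field: let $K\subset\mathbb{R}$ be a subfield in which every positive element has a square root in $K$ (for instance the field of constructible numbers). A line is in $K$ if it passes through two points of $K^2$. A conic (parabola, ellipse or hyperbola) is in $K$ if its foci are in $K^2$, its directrix line is in $K$, and its eccentricity is in $K$. $C$-constructible points: let $C$ be a non-degenerate conic in the field of constructible numbers. A point is $C$-constructible if it is obtained from the initial set $\{0,1\}$ by the same inductive process as conic-constructible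 points, except that the conics drawn in step (iii) are confined to the single fixed conic $C$ (so at each stage one adjoins the intersection points of the drawn lines, the drawn circles, and $C$ once it can be drawn). *)

theory Defs
  imports "HOL-Analysis.Analysis"
begin

definition lines_through :: "complex set \<Rightarrow> complex set set" where
  "lines_through P = {affine hull {a, b} | a b. a \<in> P \<and> b \<in> P \<and> a \<noteq> b}"

definition drawn_circles :: "complex set \<Rightarrow> complex set set" where
  "drawn_circles P = {sphere a (dist a b) | a b. a \<in> P \<and> b \<in> P \<and> a \<noteq> b}"

text \<open>Focus-directrix definition of the non-degenerate conics: \<open>e < 1\<close> gives the ellipses,
  \<open>e = 1\<close> the parabolas and \<open>e > 1\<close> the hyperbolas (with both branches).  A degenerate locus is
  excluded by \<open>f \<notin> l\<close>; a circle has no directrix and is not of this form.\<close>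

definition conic_with :: "complex set \<Rightarrow> complex \<Rightarrow> complex set \<Rightarrow> real \<Rightarrow> bool" where
  "conic_with S f l e \<longleftrightarrow>
     l \<in> lines_through UNIV \<and> f \<notin> l \<and> e > 0 \<and> S = {z. dist z f = e * infdist z l}"

text \<open>One focus for a parabola, two for an ellipse or a hyperbola.\<close>

definition foci :: "complex set \<Rightarrow> complex set" where
  "foci S = {f. \<exists>l e. conic_with S f l e}"

definition drawn_conics :: "complex set \<Rightarrow> complex set set" where
  "drawn_conics P = {S. foci S \<subseteq> P \<and>
     (\<exists>f l e. conic_with S f l e \<and> l \<in> lines_through P \<and> (\<exists>a\<in>P. \<exists>b\<in>P. e = dist a b))}"

text \<open>The parameter \<open>\<F>\<close> is the family of conics that are permitted to be drawn.  Only distinct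
  curves have intersection points; otherwise every point of a drawn curve would be adjoined.\<close>

definition drawn_curves :: "complex set set \<Rightarrow> complex set \<Rightarrow> complex set set" where
  "drawn_curves \<F> P = lines_through P \<union> drawn_circles P \<union> (drawn_conics P \<inter> \<F>)"

primrec stage :: "complex set set \<Rightarrow> nat \<Rightarrow> complex set" where
  "stage \<F> 0 = {0, 1}"
| "stage \<F> (Suc k) = stage \<F> k \<union>
     {z. \<exists>A \<in> drawn_curves \<F> (stage \<F> k). \<exists>B \<in> drawn_curves \<F> (stage \<F> k).
           A \<noteq> B \<and> z \<in> A \<inter> B}"

definition constructible_points :: "complex set" where
  "constructible_points = (\<Union>k. stage {} k)"

definition constructible_numbers :: "real set" where
  "constructible_numbers = Re ` constructible_points"

definition conic_constructible_points :: "complex set" where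
  "conic_constructible_points = (\<Union>k. stage UNIV k)"

definition C_constructible_points :: "complex set \<Rightarrow> complex set" where
  "C_constructible_points C = (\<Union>k. stage {C} k)"

definition plane_over :: "real set \<Rightarrow> complex set" where
  "plane_over K = {z. Re z \<in> K \<and> Im z \<in> K}"

definition conic_in :: "real set \<Rightarrow> complex set \<Rightarrow> bool" where
  "conic_in K S \<longleftrightarrow> foci S \<subseteq> plane_over K \<and>
     (\<exists>f l e. conic_with S f l e \<and> l \<in> lines_through (plane_over K) \<and> e \<in> K)"

end

theory Submission
  imports Defs
begin

text \<open>Let \<open>M\<close> be the set of \<open>C\<close>-constructible points. Ruler and compass alone make \<open>M\<close> equal to \<open>K + \<i> K\<close>
for a subfield \<open>K\<close> of the reals that is closed under square roots
(\<open>plane_over_real_points\<close> and the sublocale after it), so the theorem says that intersecting a conic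
over \<open>K\<close> with a line, a circle or a conic over \<open>K\<close> never leaves \<open>K + \<i> K\<close>.

Every conic over \<open>K\<close> is carried by a similarity \<open>w \<mapsto> p + m w\<close> over \<open>K\<close> to
\<open>y\<^sup>2 = 2 x + b x\<^sup>2\<close> with \<open>b = e\<^sup>2 - 1\<close> (\<open>conic_normal_form\<close>), and the slope \<open>t = y / x\<close> parametrizes
this curve rationally. A second curve, given by a quadratic polynomial over \<open>K\<close>, then meets the conic at
the roots \<open>t\<close> of a polynomial of degree at most four over \<open>K\<close>, which vanishes identically only when the
two curves coincide or the quadratic polynomial is zero (\<open>conic_meets_quadratic_curve\<close>). It remains to see
that \<open>K\<close> contains every real root of a nonzero polynomial of degree at most four over \<open>K\<close>
(\<open>quartic_root_mem\<close>), and this is where the fixed conic \<open>C\<close> comes in.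

For \<open>C\<close> itself and the circles over \<open>K\<close>, the coefficients of the quartics in \<open>t\<close> satisfy one linear relation,
\<open>c\<^sub>1 = - b c\<^sub>3\<close>. Conversely every monic quartic with this relation arises in this way, apart from a
degenerate case that only needs square roots (\<open>special_quartic_root_mem\<close>). A cubic becomes such a
quartic when it is multiplied by a suitable linear factor, after a translation and a scaling of the variable. A general quartic \<open>P\<close> becomes one after a translation by \<open>h\<close>, because the relation for
\<open>P (t + h)\<close> is a cubic equation for \<open>h\<close>; that cubic has a real root, and this root lies in \<open>K\<close> by the
case just treated.

One point about the construction is not algebraic: \<open>C\<close> must be drawn at some finite stage, and this requires
all of its foci to be available at a single stage. Comparing two normal forms of the same conic shows that it
has at most two foci (\<open>finite_foci\<close>).\<close>

section \<open>Euclidean subfields and roots of quartics\<close>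

text \<open>The coordinate fields of ruler-and-compass geometry.\<close>

locale euclidean_subfield =
  fixes K :: "real set"
  assumes one_mem: "1 \<in> K"
    and diff_mem: "\<lbrakk>x \<in> K; y \<in> K\<rbrakk> \<Longrightarrow> x - y \<in> K"
    and mult_mem: "\<lbrakk>x \<in> K; y \<in> K\<rbrakk> \<Longrightarrow> x * y \<in> K"
    and inverse_mem: "\<lbrakk>x \<in> K; x \<noteq> 0\<rbrakk> \<Longrightarrow> inverse x \<in> K"
    and sqrt_mem: "\<lbrakk>x \<in> K; 0 \<le> x\<rbrakk> \<Longrightarrow> sqrt x \<in> K"
begin

lemma zero_mem: "0 \<in> K"
  using diff_mem[OF one_mem one_mem] by simp

lemma minus_mem: "x \<in> K \<Longrightarrow> - x \<in> K"
  using diff_mem[OF zero_mem] by simp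

lemma add_mem: "\<lbrakk>x \<in> K; y \<in> K\<rbrakk> \<Longrightarrow> x + y \<in> K"
  using diff_mem[OF _ minus_mem] by simp

lemma divide_mem: "\<lbrakk>x \<in> K; y \<in> K\<rbrakk> \<Longrightarrow> x / y \<in> K"
  by (cases "y = 0") (auto simp: zero_mem divide_inverse intro: mult_mem inverse_mem)

lemma power_mem: "x \<in> K \<Longrightarrow> x ^ n \<in> K"
  by (induction n) (auto intro: one_mem mult_mem)

lemma numeral_mem: "numeral n \<in> K"
  by (induction n) (simp_all only: numeral.simps one_mem add_mem)

lemmas mem_rules = zero_mem one_mem numeral_mem add_mem diff_mem minus_mem mult_mem
  divide_mem power_mem

lemma square_root_mem:
  assumes "x\<^sup>2 \<in> K"
  shows "x \<in> K"
proof -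
  have "\<bar>x\<bar> \<in> K"
    using sqrt_mem[OF assms] by simp
  then show ?thesis
    using minus_mem[of "\<bar>x\<bar>"] by (cases "x \<ge> 0") auto
qed

lemma quadratic_root_mem:
  assumes K: "a \<in> K" "b \<in> K" "c \<in> K"
    and nz: "a \<noteq> 0 \<or> b \<noteq> 0 \<or> c \<noteq> 0"
    and root: "a * t\<^sup>2 + b * t + c = 0"
  shows "t \<in> K"
proof (cases "a = 0")
  case True
  with nz root have "b \<noteq> 0" by auto
  with True root have "t = - c / b" by (simp add: field_simps)
  then show ?thesis using K by (auto intro!: mem_rules)
next
  case False
  have "(2 * a * t + b)\<^sup>2 = b\<^sup>2 - 4 * a * c"
    using root by algebra
  moreover have "b\<^sup>2 - 4 * a * c \<in> K" by (intro mem_rules K)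
  ultimately have "2 * a * t + b \<in> K"
    by (simp only: square_root_mem)
  then have "((2 * a * t + b) - b) / (2 * a) \<in> K"
    by (intro divide_mem diff_mem mult_mem K numeral_mem)
  then show ?thesis using False by simp
qed

lemma plane_over_of_real: "x \<in> K \<Longrightarrow> complex_of_real x \<in> plane_over K"
  by (simp add: plane_over_def zero_mem)

lemma plane_over_constants: "numeral n \<in> plane_over K" "1 \<in> plane_over K" "0 \<in> plane_over K"
    "\<i> \<in> plane_over K"
  by (simp_all add: plane_over_def mem_rules)

lemma plane_over_add: "\<lbrakk>z \<in> plane_over K; w \<in> plane_over K\<rbrakk> \<Longrightarrow> z + w \<in> plane_over K"
  and plane_over_diff: "\<lbrakk>z \<in> plane_over K; w \<in> plane_over K\<rbrakk> \<Longrightarrow> z - w \<in> plane_over K"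
  and plane_over_mult: "\<lbrakk>z \<in> plane_over K; w \<in> plane_over K\<rbrakk> \<Longrightarrow> z * w \<in> plane_over K"
  and plane_over_minus: "z \<in> plane_over K \<Longrightarrow> - z \<in> plane_over K"
  and plane_over_cnj: "z \<in> plane_over K \<Longrightarrow> cnj z \<in> plane_over K"
  by (auto simp: plane_over_def intro!: mem_rules)

lemma plane_over_divide: "\<lbrakk>z \<in> plane_over K; w \<in> plane_over K\<rbrakk> \<Longrightarrow> z / w \<in> plane_over K"
  by (auto simp: plane_over_def Re_divide Im_divide intro!: mem_rules)

lemma plane_over_power: "z \<in> plane_over K \<Longrightarrow> z ^ n \<in> plane_over K"
  by (induction n) (auto intro: plane_over_mult plane_over_constants)

lemmas plane_over_rules = plane_over_of_real plane_over_constants plane_over_add plane_over_diff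
  plane_over_mult plane_over_minus plane_over_cnj plane_over_divide plane_over_power

lemma Re_mem: "z \<in> plane_over K \<Longrightarrow> Re z \<in> K"
  and Im_mem: "z \<in> plane_over K \<Longrightarrow> Im z \<in> K"
  by (simp_all add: plane_over_def)

lemma norm_mem: "z \<in> plane_over K \<Longrightarrow> norm z \<in> K"
  by (rule square_root_mem) (auto simp: cmod_power2 plane_over_def intro!: mem_rules)

end

lemma monic_cubic_has_real_root: "\<exists>h::real. h ^ 3 + a * h\<^sup>2 + b * h + c = 0"
proof -
  define A B C where "A = \<bar>a\<bar>" and "B = \<bar>b\<bar>" and "C = \<bar>c\<bar>"
  \<comment> \<open>the cubic term dominates the others outside the interval from \<open>-N\<close> to \<open>N\<close>\<close>
  define N where "N = 1 + A + B + C"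
  let ?f = "\<lambda>h. h ^ 3 + a * h\<^sup>2 + b * h + c"
  have ABC: "A \<ge> 0" "B \<ge> 0" "C \<ge> 0" by (simp_all add: A_def B_def C_def)
  then have N1: "N \<ge> 1" by (simp add: N_def)
  have NN: "N \<le> N\<^sup>2" "1 \<le> N\<^sup>2"
    using N1 self_le_power[of N 2] one_le_power[of N 2] by simp_all
  have cube: "N ^ 3 = N\<^sup>2 + A * N\<^sup>2 + B * N\<^sup>2 + C * N\<^sup>2"
  proof -
    have "N ^ 3 = N * N\<^sup>2" by (simp add: power3_eq_cube power2_eq_square)
    also have "\<dots> = (1 + A + B + C) * N\<^sup>2" by (simp only: N_def)
    finally show ?thesis by (simp only: distrib_right mult_1_left)
  qed
  have "\<bar>a * N\<^sup>2\<bar> \<le> A * N\<^sup>2" by (simp add: abs_mult A_def)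
  then have a: "a * N\<^sup>2 \<le> A * N\<^sup>2" "- (a * N\<^sup>2) \<le> A * N\<^sup>2" by (simp_all only: abs_le_iff)
  have "\<bar>b * N\<bar> \<le> B * N\<^sup>2"
    using N1 mult_left_mono[OF NN(1) ABC(2)] by (simp add: abs_mult B_def)
  then have b: "b * N \<le> B * N\<^sup>2" "- (b * N) \<le> B * N\<^sup>2" by (simp_all only: abs_le_iff)
  have "\<bar>c\<bar> \<le> C * N\<^sup>2"
    using mult_left_mono[OF NN(2) ABC(3)] by (simp add: C_def)
  then have c: "c \<le> C * N\<^sup>2" "- c \<le> C * N\<^sup>2" by (simp_all only: abs_le_iff)
  have 1: "?f N \<ge> 0" using a b c cube NN by linarith
  have 2: "?f (- N) \<le> 0"
  proof -
    have "(- N) ^ 3 = - (N ^ 3)" by (simp add: power3_eq_cube)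
    then show ?thesis
      using a b c cube NN unfolding power2_minus mult_minus_right by linarith
  qed
  have cont: "continuous_on {-N..N} ?f" by (intro continuous_intros)
  have "-N \<le> N" using N1 by simp
  from IVT'[of ?f, OF 2 1 this cont] obtain h where "?f h = 0" by auto
  then show ?thesis by (rule exI[of _ h])
qed

text \<open>The contribution of the fixed conic to the field: in the normal form of that conic, its intersections
with circles over \<open>K\<close> have coordinates in \<open>K\<close>.\<close>

locale conic_circle_closed = euclidean_subfield +
  fixes b :: real
  assumes b_mem: "b \<in> K" and b_gt: "b > -1"
    and meet_mem: "\<lbrakk>u \<in> K; v \<in> K; w \<in> K; y\<^sup>2 = 2 * x + b * x\<^sup>2;
       x\<^sup>2 + y\<^sup>2 - 2 * u * x - 2 * v * y + w = 0\<rbrakk> \<Longrightarrow> x \<in> K \<and> y \<in> K"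
begin

text \<open>On \<open>y\<^sup>2 = 2 x + b x\<^sup>2\<close> the slope \<open>t = y / x\<close> gives \<open>x = 2 / (t\<^sup>2 - b)\<close> and \<open>y = t x\<close>. Substituting this
into \<open>s (x\<^sup>2 + y\<^sup>2) - 2 u x - 2 v y + 1 = 0\<close> and clearing denominators yields a monic quartic in \<open>t\<close>, and
the relation \<open>c\<^sub>1 = - b c\<^sub>3\<close> between its coefficients is exactly what is needed to solve for
\<open>s\<close>, \<open>u\<close> and \<open>v\<close>. When \<open>s = 0\<close> the circle degenerates to a line, but then the quartic is divisible by
\<open>t\<^sup>2 - b\<close> and a quadratic equation remains.\<close>

lemma special_quartic_root_mem:
  assumes K: "c3 \<in> K" "c2 \<in> K" "c0 \<in> K"
    and root: "t ^ 4 + c3 * t ^ 3 + c2 * t\<^sup>2 - b * c3 * t + c0 = 0"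
  shows "t \<in> K"
proof (cases "t\<^sup>2 = b")
  case True
  then show ?thesis using b_mem by (simp only: square_root_mem)
next
  case False
  define s where "s = (c0 + b * c2 + b\<^sup>2) / (4 * (1 + b))"
  define u where "u = s - (c2 + 2 * b) / 4"
  define v where "v = - c3 / 4"
  have in_K: "s \<in> K" "u \<in> K" "v \<in> K"
    unfolding s_def u_def v_def by (intro mem_rules K b_mem)+
  have c0: "c0 = 4 * s * (1 + b) - b * c2 - b\<^sup>2"
  proof -
    have "4 * (1 + b) \<noteq> 0" using b_gt by simp
    then have "s * (4 * (1 + b)) = c0 + b * c2 + b\<^sup>2" by (simp add: s_def)
    then show ?thesis by (simp add: algebra_simps)
  qed
  have eq: "4 * s * (1 + t\<^sup>2) - 4 * u * (t\<^sup>2 - b) - 4 * v * t * (t\<^sup>2 - b) + (t\<^sup>2 - b)\<^sup>2 = 0"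
    using root unfolding c0 u_def v_def by (simp add: field_simps power2_eq_square power3_eq_cube
        power4_eq_xxxx)
  show ?thesis
  proof (cases "s = 0")
    case True
    with eq have "(t\<^sup>2 - b) * (1 * t\<^sup>2 + (- 4 * v) * t + (- 4 * u - b)) = 0"
      by algebra
    with False have "1 * t\<^sup>2 + (- 4 * v) * t + (- 4 * u - b) = 0" by simp
    then show ?thesis
      by (rule quadratic_root_mem[rotated -1]) (use in_K b_mem in \<open>auto intro!: mem_rules\<close>)
  next
    case s: False
    define x where "x = 2 / (t\<^sup>2 - b)"
    define y where "y = t * x"
    have ne: "t\<^sup>2 - b \<noteq> 0" using False by simp
    have x: "x * (t\<^sup>2 - b) = 2" "x \<noteq> 0"
      using ne by (intro nonzero_eq_divide_eq[OF ne, THEN iffD1] x_def, simp add: x_def)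
    have on_conic: "y\<^sup>2 = 2 * x + b * x\<^sup>2"
    proof -
      have "y\<^sup>2 = (x * (t\<^sup>2 - b)) * x + b * x\<^sup>2"
        unfolding y_def by (simp add: power2_eq_square algebra_simps)
      then show ?thesis using x by simp
    qed
    have "s * (x\<^sup>2 + y\<^sup>2) - u * x * (x * (t\<^sup>2 - b)) - v * y * (x * (t\<^sup>2 - b))
        + (x * (t\<^sup>2 - b))\<^sup>2 / 4
      = x\<^sup>2 / 4 * (4 * s * (1 + t\<^sup>2) - 4 * u * (t\<^sup>2 - b) - 4 * v * t * (t\<^sup>2 - b) + (t\<^sup>2 - b)\<^sup>2)"
      unfolding y_def by (simp add: power2_eq_square field_simps)
    then have "s * (x\<^sup>2 + y\<^sup>2) - 2 * u * x - 2 * v * y + 1 = 0"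
      unfolding eq x(1) by simp
    moreover have "x\<^sup>2 + y\<^sup>2 - 2 * (u / s) * x - 2 * (v / s) * y + 1 / s
        = (s * (x\<^sup>2 + y\<^sup>2) - 2 * u * x - 2 * v * y + 1) / s"
      using s by (simp add: field_simps)
    ultimately have on_circle: "x\<^sup>2 + y\<^sup>2 - 2 * (u / s) * x - 2 * (v / s) * y + 1 / s = 0"
      by (simp only: div_0)
    have "x \<in> K \<and> y \<in> K"
      by (rule meet_mem[OF _ _ _ on_conic on_circle]) (intro mem_rules in_K)+
    then have "y / x \<in> K" by (simp only: divide_mem)
    then show ?thesis using x by (simp add: y_def)
  qed
qed

text \<open>After scaling the variable by \<open>\<mu>\<close>, the product of the cubic with \<open>t - k\<close> satisfies the relation of
\<open>special_quartic_root_mem\<close> precisely when \<open>k (\<mu>\<^sup>2 p + b) = \<mu>\<^sup>2 q + b m\<close>. The condition \<open>p \<noteq> 0\<close> lets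
\<open>\<mu>\<close> be chosen so that this can be solved for \<open>k\<close>.\<close>

lemma cubic_root_mem_linear_term:
  assumes K: "m \<in> K" "p \<in> K" "q \<in> K" and "p \<noteq> 0"
    and root: "t ^ 3 + m * t\<^sup>2 + p * t + q = 0"
  shows "t \<in> K"
proof -
  obtain \<mu> :: real where \<mu>: "\<mu> \<in> K" "\<mu> \<noteq> 0" "\<mu>\<^sup>2 * p + b \<noteq> 0"
  proof (cases "p + b = 0")
    case True
    with \<open>p \<noteq> 0\<close> show ?thesis by (intro that[of 2]) (auto intro: mem_rules)
  next
    case False
    with one_mem show ?thesis by (intro that[of 1]) auto
  qed
  define k where "k = (\<mu>\<^sup>2 * q + b * m) / (\<mu>\<^sup>2 * p + b)"
  have k: "k \<in> K" unfolding k_def by (intro mem_rules K b_mem \<mu>)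
  have k_eq: "k * (\<mu>\<^sup>2 * p + b) = \<mu>\<^sup>2 * q + b * m"
    using \<mu> by (simp add: k_def)
  have "(\<mu> * t) ^ 4 + (\<mu> * (m - k)) * (\<mu> * t) ^ 3 + (\<mu>\<^sup>2 * (p - k * m)) * (\<mu> * t)\<^sup>2
      - b * (\<mu> * (m - k)) * (\<mu> * t) + (- (\<mu> ^ 4) * k * q)
    = \<mu> ^ 4 * (t - k) * (t ^ 3 + m * t\<^sup>2 + p * t + q)
      + \<mu>\<^sup>2 * t * (k * (\<mu>\<^sup>2 * p + b) - (\<mu>\<^sup>2 * q + b * m))"
    by (simp add: algebra_simps eval_nat_numeral)
  also have "\<dots> = 0" unfolding root k_eq by simp
  finally have "(\<mu> * t) ^ 4 + (\<mu> * (m - k)) * (\<mu> * t) ^ 3 + (\<mu>\<^sup>2 * (p - k * m)) * (\<mu> * t)\<^sup>2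
      - b * (\<mu> * (m - k)) * (\<mu> * t) + (- (\<mu> ^ 4) * k * q) = 0" .
  then have "\<mu> * t \<in> K"
    by (rule special_quartic_root_mem[rotated -1]) (intro mem_rules K k \<mu>)+
  then have "\<mu> * t / \<mu> \<in> K" using \<mu> by (intro divide_mem)
  then show ?thesis using \<mu> by simp
qed

text \<open>The linear coefficient of the cubic translated by \<open>h\<close> is its derivative at \<open>h\<close>, a quadratic polynomial
in \<open>h\<close> that cannot vanish at all of \<open>0\<close>, \<open>1\<close> and \<open>-1\<close>.\<close>

lemma monic_cubic_root_mem:
  assumes K: "m \<in> K" "p \<in> K" "q \<in> K"
    and root: "t ^ 3 + m * t\<^sup>2 + p * t + q = 0"
  shows "t \<in> K"
proof -
  obtain h where h: "h \<in> K" "p + 2 * m * h + 3 * h\<^sup>2 \<noteq> 0"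
  proof -
    have "p \<noteq> 0 \<or> p + 2 * m + 3 \<noteq> 0 \<or> p - 2 * m + 3 \<noteq> 0" by linarith
    then show ?thesis
      using that[of 0] that[of 1] that[of "-1"] zero_mem one_mem minus_mem[OF one_mem]
      by (elim disjE) simp_all
  qed
  have "(t - h) ^ 3 + (m + 3 * h) * (t - h)\<^sup>2 + (p + 2 * m * h + 3 * h\<^sup>2) * (t - h)
      + (q + p * h + m * h\<^sup>2 + h ^ 3) = 0"
    using root by algebra
  then have "t - h \<in> K"
    by (rule cubic_root_mem_linear_term[rotated -1]) (intro mem_rules K h)+
  then have "t - h + h \<in> K" using h by (intro add_mem)
  then show ?thesis by simp
qed

text \<open>Translated by \<open>h\<close>, the quartic has its derivative at \<open>h\<close> as linear coefficient and \<open>c\<^sub>3 + 4 h\<close>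
as cubic coefficient, so the relation of \<open>special_quartic_root_mem\<close> for it is a cubic equation over \<open>K\<close>
for \<open>h\<close>.\<close>

lemma monic_quartic_root_mem:
  assumes K: "c3 \<in> K" "c2 \<in> K" "c1 \<in> K" "c0 \<in> K"
    and root: "t ^ 4 + c3 * t ^ 3 + c2 * t\<^sup>2 + c1 * t + c0 = 0"
  shows "t \<in> K"
proof -
  obtain h where h: "h ^ 3 + (3 * c3 / 4) * h\<^sup>2 + (c2 / 2 + b) * h + (c1 + b * c3) / 4 = 0"
    using monic_cubic_has_real_root by blast
  have hK: "h \<in> K"
    by (rule monic_cubic_root_mem[OF _ _ _ h]) (intro mem_rules K b_mem)+
  have h': "4 * h ^ 3 + 3 * c3 * h\<^sup>2 + 2 * c2 * h + c1 = - b * (c3 + 4 * h)"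
    using h by (simp add: field_simps)
  have "(t - h) ^ 4 + (c3 + 4 * h) * (t - h) ^ 3 + (c2 + 3 * c3 * h + 6 * h\<^sup>2) * (t - h)\<^sup>2
      - b * (c3 + 4 * h) * (t - h) + (h ^ 4 + c3 * h ^ 3 + c2 * h\<^sup>2 + c1 * h + c0) = 0"
    using h' root by algebra
  then have "t - h \<in> K"
    by (rule special_quartic_root_mem[rotated -1]) (intro mem_rules K hK)+
  then have "t - h + h \<in> K" using hK by (intro add_mem)
  then show ?thesis by simp
qed

lemma quartic_root_mem:
  assumes K: "c4 \<in> K" "c3 \<in> K" "c2 \<in> K" "c1 \<in> K" "c0 \<in> K"
    and nz: "\<not> (c4 = 0 \<and> c3 = 0 \<and> c2 = 0 \<and> c1 = 0 \<and> c0 = 0)"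
    and root: "c4 * t ^ 4 + c3 * t ^ 3 + c2 * t\<^sup>2 + c1 * t + c0 = 0"
  shows "t \<in> K"
proof (cases "c4 = 0")
  case False
  have "t ^ 4 + (c3 / c4) * t ^ 3 + (c2 / c4) * t\<^sup>2 + (c1 / c4) * t + c0 / c4 = 0"
    using root False by (simp add: field_simps)
  then show ?thesis
    by (rule monic_quartic_root_mem[rotated -1]) (intro mem_rules K)+
next
  case c4: True
  show ?thesis
  proof (cases "c3 = 0")
    case False
    have "t ^ 3 + (c2 / c3) * t\<^sup>2 + (c1 / c3) * t + c0 / c3 = 0"
      using root False c4 by (simp add: field_simps)
    then show ?thesis
      by (rule monic_cubic_root_mem[rotated -1]) (intro mem_rules K)+
  next
    case True
    have "c2 \<noteq> 0 \<or> c1 \<noteq> 0 \<or> c0 \<noteq> 0" using nz c4 True by blast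
    moreover have "c2 * t\<^sup>2 + c1 * t + c0 = 0" using root c4 True by simp
    ultimately show ?thesis by (rule quadratic_root_mem[OF K(3-5)])
  qed
qed

end

section \<open>Normal form of a conic\<close>

text \<open>In the coordinate \<open>(z - a) / (b - a)\<close> the line is the real axis.\<close>

lemma mem_line_iff:
  fixes a b z :: complex
  assumes "a \<noteq> b"
  shows "z \<in> affine hull {a, b} \<longleftrightarrow> Im ((z - a) / (b - a)) = 0"
proof
  assume "z \<in> affine hull {a, b}"
  then obtain u where "z = a + u *\<^sub>R (b - a)"
    by (auto simp: affine_hull_2_alt)
  then have "(z - a) / (b - a) = of_real u"
    using assms by (simp add: scaleR_conv_of_real)
  then show "Im ((z - a) / (b - a)) = 0" by simp
next
  assume "Im ((z - a) / (b - a)) = 0"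
  then have "(z - a) / (b - a) = of_real (Re ((z - a) / (b - a)))"
    by (simp add: complex_eq_iff)
  then have "z = a + Re ((z - a) / (b - a)) *\<^sub>R (b - a)"
    using assms by (simp add: scaleR_conv_of_real field_simps)
  then show "z \<in> affine hull {a, b}"
    unfolding affine_hull_2_alt by blast
qed

lemma infdist_line:
  fixes d g z :: complex
  assumes "g \<noteq> 0"
  shows "infdist z {z. Re ((z - d) / g) = 0} = \<bar>Re ((z - d) / g)\<bar> * norm g"
    (is "infdist z ?l = ?r")
proof (rule antisym)
  let ?p = "z - of_real (Re ((z - d) / g)) * g"
  have "(?p - d) / g = (z - d) / g - of_real (Re ((z - d) / g))"
    using assms by (simp add: field_simps)
  then have "?p \<in> ?l" by simp
  then have "infdist z ?l \<le> dist z ?p" by (rule infdist_le)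
  also have "\<dots> = ?r" by (simp add: dist_norm norm_mult)
  finally show "infdist z ?l \<le> ?r" .
next
  have "d \<in> ?l" by simp
  then have ne: "?l \<noteq> {}" by blast
  have "?r \<le> dist z q" if "q \<in> ?l" for q
  proof -
    have "(z - q) / g = (z - d) / g - (q - d) / g"
      by (simp add: diff_divide_distrib)
    then have "\<bar>Re ((z - d) / g)\<bar> = \<bar>Re ((z - q) / g)\<bar>"
      using that by simp
    also have "\<dots> \<le> norm ((z - q) / g)" by (rule abs_Re_le_cmod)
    finally have "?r \<le> norm ((z - q) / g) * norm g"
      by (rule mult_right_mono) simp
    then show ?thesis
      using assms by (simp add: dist_norm norm_divide)
  qed
  then show "?r \<le> infdist z ?l"
    unfolding infdist_notempty[OF ne] by (intro cINF_greatest ne)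
qed

text \<open>The point \<open>d\<close> is the foot of the perpendicular from \<open>f\<close>. Relative to the perpendicular \<open>f - d\<close> the line
is the imaginary axis, the form in which \<open>infdist_line\<close> measures distances.\<close>

lemma line_from_foot:
  fixes a b f :: complex
  assumes "a \<noteq> b" and "f \<notin> affine hull {a, b}"
  defines "d \<equiv> a + (b - a) * of_real (Re ((f - a) / (b - a)))"
  shows "f \<noteq> d" and "affine hull {a, b} = {z. Re ((z - d) / (f - d)) = 0}"
proof -
  define \<sigma> where "\<sigma> = Im ((f - a) / (b - a))"
  have \<sigma>: "\<sigma> \<noteq> 0" using assms mem_line_iff by (auto simp: \<sigma>_def)
  have "f - a = (b - a) * ((f - a) / (b - a))" using assms(1) by simp
  also have "(f - a) / (b - a) = of_real (Re ((f - a) / (b - a))) + \<i> * of_real \<sigma>"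
    unfolding \<sigma>_def by (rule complex_eq)
  finally have g: "f - d = (b - a) * (\<i> * of_real \<sigma>)"
    unfolding d_def by (simp only: distrib_left diff_add_eq_diff_diff_swap) (simp add: algebra_simps)
  then show "f \<noteq> d" using assms(1) \<sigma> by auto
  have "Re ((z - d) / (f - d)) = Im ((z - a) / (b - a)) / \<sigma>" for z
  proof -
    have "z - d = (b - a) * ((z - a) / (b - a) - of_real (Re ((f - a) / (b - a))))"
      unfolding d_def right_diff_distrib using assms(1) by simp
    then have "(z - d) / (f - d)
        = ((z - a) / (b - a) - of_real (Re ((f - a) / (b - a)))) / (\<i> * of_real \<sigma>)"
      unfolding g using assms(1) by (simp only: mult_divide_mult_cancel_left right_minus_eq)
    then show ?thesis by (simp add: Re_divide power2_eq_square)
  qed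
  then show "affine hull {a, b} = {z. Re ((z - d) / (f - d)) = 0}"
    using \<sigma> mem_line_iff[OF assms(1)] by auto
qed

text \<open>The conic with eccentricity \<open>sqrt (b + 1)\<close> that passes through the origin with vertical tangent there,
scaled so that its semi-latus rectum is 1. It is the common normal form of ellipses, parabolas and
hyperbolas.\<close>

definition vertex_conic :: "real \<Rightarrow> complex set" where
  "vertex_conic b = {w. (Im w)\<^sup>2 = 2 * Re w + b * (Re w)\<^sup>2}"

text \<open>The new origin is the vertex, which divides the segment from the foot \<open>d\<close> to the focus \<open>d + g\<close> in the
ratio 1 : e. Scaling by \<open>e |g|\<close> makes the semi-latus rectum 1.\<close>

lemma focus_directrix_vertex_equation:
  fixes d g w :: complex and e :: real
  assumes "e > 0" and "g \<noteq> 0"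
  defines "z \<equiv> d + g / of_real (1 + e) + of_real e * g * w"
  shows "norm (z - (d + g)) = e * (\<bar>Re ((z - d) / g)\<bar> * norm g) \<longleftrightarrow> w \<in> vertex_conic (e\<^sup>2 - 1)"
proof -
  define k where "k = 1 / (1 + e)"
  have k: "k * (1 + e) = 1" using assms by (simp add: k_def)
  have z: "z = d + g * of_real k + of_real e * g * w"
    by (simp add: z_def k_def)
  have "z - (d + g) = g * (of_real e * (w - of_real k)) + g * of_real (k * (1 + e) - 1)"
    unfolding z by (simp add: algebra_simps)
  then have l: "norm (z - (d + g)) = e * norm g * norm (w - of_real k)"
    using assms(1) k by (simp add: norm_mult)
  have "(z - d) / g = of_real k + of_real e * w"
    using assms(2) unfolding z by (simp add: divide_simps) (simp add: algebra_simps)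
  then have r: "Re ((z - d) / g) = k + e * Re w" by simp
  have "norm (z - (d + g)) = e * (\<bar>Re ((z - d) / g)\<bar> * norm g)
      \<longleftrightarrow> norm (w - of_real k) = \<bar>k + e * Re w\<bar>"
    unfolding l r using assms(1,2) by simp
  also have "\<dots> \<longleftrightarrow> (norm (w - of_real k))\<^sup>2 = \<bar>k + e * Re w\<bar>\<^sup>2"
    by (simp only: power2_eq_iff_nonneg norm_ge_zero abs_ge_zero)
  also have "\<dots> \<longleftrightarrow> (Re w - k)\<^sup>2 + (Im w)\<^sup>2 = (k + e * Re w)\<^sup>2"
    by (simp add: cmod_power2)
  also have "\<dots> \<longleftrightarrow> (Im w)\<^sup>2 = 2 * (k * (1 + e)) * Re w + (e\<^sup>2 - 1) * (Re w)\<^sup>2"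
    by (simp add: power2_eq_square algebra_simps)
  finally show ?thesis by (simp add: vertex_conic_def k)
qed

lemma (in euclidean_subfield) conic_normal_form:
  assumes "conic_with S f l e" and f: "f \<in> plane_over K" and l: "l \<in> lines_through (plane_over K)"
    and e: "e \<in> K"
  obtains p m where "p \<in> plane_over K" "m \<in> plane_over K" "m \<noteq> 0"
    "f = p + m / of_real (1 + e)"
    "\<And>w. p + m * w \<in> S \<longleftrightarrow> w \<in> vertex_conic (e\<^sup>2 - 1)"
proof -
  obtain a b where ab: "a \<in> plane_over K" "b \<in> plane_over K" "a \<noteq> b" "l = affine hull {a, b}"
    using l by (auto simp: lines_through_def)
  have fl: "f \<notin> affine hull {a, b}" and e0: "e > 0" and S: "S = {z. dist z f = e * infdist z l}"
    using assms(1) ab(4) by (auto simp: conic_with_def)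
  define d where "d = a + (b - a) * of_real (Re ((f - a) / (b - a)))"
  have fd: "f \<noteq> d" and l': "l = {z. Re ((z - d) / (f - d)) = 0}"
    using line_from_foot[OF ab(3) fl] by (simp_all add: d_def ab(4))
  have d: "d \<in> plane_over K"
    unfolding d_def using ab f by (intro plane_over_rules Re_mem)
  define g where "g = f - d"
  have g: "g \<noteq> 0" "f = d + g" using fd by (auto simp: g_def)
  show thesis
  proof
    show "d + g / of_real (1 + e) \<in> plane_over K" "of_real e * g \<in> plane_over K"
      unfolding g_def using d f e by (intro plane_over_rules mem_rules; simp)+
    show "of_real e * g \<noteq> 0" using e0 g by simp
    have E: "complex_of_real (1 + e) \<noteq> 0"
      unfolding of_real_eq_0_iff using e0 by simp
    have "g / of_real (1 + e) + of_real e * g / of_real (1 + e)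
        = of_real (1 + e) * g / of_real (1 + e)"
      by (simp add: add_divide_distrib distrib_right)
    also have "\<dots> = g" by (rule nonzero_mult_div_cancel_left[OF E])
    finally have sum: "g / of_real (1 + e) + of_real e * g / of_real (1 + e) = g" .
    show "f = d + g / of_real (1 + e) + of_real e * g / of_real (1 + e)"
      unfolding add.assoc sum by (rule g(2))
    show "d + g / of_real (1 + e) + of_real e * g * w \<in> S \<longleftrightarrow> w \<in> vertex_conic (e\<^sup>2 - 1)" for w
      unfolding S g(2) dist_norm l'[folded g_def] mem_Collect_eq infdist_line[OF g(1)]
      by (rule focus_directrix_vertex_equation[OF e0 g(1)])
  qed
qed

section \<open>Quadratic curves on a conic in normal form\<close>

text \<open>The line of slope \<open>t\<close> through the vertex meets the conic in one further point; substituting its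
coordinates turns a quadratic polynomial into a quartic in \<open>t\<close>.\<close>

lemma vertex_conic_slope_form:
  fixes x y b \<alpha> \<beta> \<gamma> \<delta> \<epsilon> \<zeta> :: real
  assumes "x \<noteq> 0" and "y\<^sup>2 = 2 * x + b * x\<^sup>2"
  defines "t \<equiv> y / x"
  shows "x * (t\<^sup>2 - b) = 2" and
   "\<zeta> * t ^ 4 + 2 * \<epsilon> * t ^ 3 + (4 * \<gamma> + 2 * \<delta> - 2 * b * \<zeta>) * t\<^sup>2
      + (4 * \<beta> - 2 * b * \<epsilon>) * t + (4 * \<alpha> - 2 * b * \<delta> + b\<^sup>2 * \<zeta>)
     = 4 / x\<^sup>2 * (\<alpha> * x\<^sup>2 + \<beta> * x * y + \<gamma> * y\<^sup>2 + \<delta> * x + \<epsilon> * y + \<zeta>)" (is "?q = _")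
proof -
  have y: "y = t * x" using assms(1) by (simp add: t_def)
  have "x * (x * (t\<^sup>2 - b)) = x * 2"
    using assms(2) unfolding y by (simp add: power2_eq_square algebra_simps)
  then show x: "x * (t\<^sup>2 - b) = 2" using mult_left_cancel[OF assms(1)] by blast
  \<comment> \<open>the factors \<open>x (t\<^sup>2 - b) / 2 = 1\<close> make every term homogeneous of degree two in \<open>x\<close>\<close>
  have "x\<^sup>2 * ?q = 4 * (\<alpha> * x\<^sup>2 + \<beta> * x * (t * x) + \<gamma> * (t * x)\<^sup>2)
      + 2 * (x * (t\<^sup>2 - b)) * (\<delta> * x + \<epsilon> * (t * x)) + \<zeta> * (x * (t\<^sup>2 - b))\<^sup>2"
    by (simp add: algebra_simps eval_nat_numeral)
  also have "\<dots> = 4 * (\<alpha> * x\<^sup>2 + \<beta> * x * y + \<gamma> * y\<^sup>2 + \<delta> * x + \<epsilon> * y + \<zeta>)"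
    unfolding x y by (simp add: algebra_simps)
  finally show "?q = 4 / x\<^sup>2 * (\<alpha> * x\<^sup>2 + \<beta> * x * y + \<gamma> * y\<^sup>2 + \<delta> * x + \<epsilon> * y + \<zeta>)"
    using assms(1) by (simp add: field_simps)
qed

lemma slope_quartic_zero:
  fixes b \<alpha> \<beta> \<gamma> \<delta> \<epsilon> \<zeta> :: real
  assumes "\<zeta> = 0 \<and> 2 * \<epsilon> = 0 \<and> 4 * \<gamma> + 2 * \<delta> - 2 * b * \<zeta> = 0 \<and> 4 * \<beta> - 2 * b * \<epsilon> = 0
      \<and> 4 * \<alpha> - 2 * b * \<delta> + b\<^sup>2 * \<zeta> = 0"
  shows "\<alpha> = - b * \<gamma> \<and> \<beta> = 0 \<and> \<delta> = - 2 * \<gamma> \<and> \<epsilon> = 0 \<and> \<zeta> = 0"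
proof -
  have "\<zeta> = 0" "\<epsilon> = 0" "\<beta> = 0" and d: "\<delta> = - 2 * \<gamma>" using assms by auto
  have "4 * \<alpha> - 2 * b * \<delta> + b\<^sup>2 * \<zeta> = 0" using assms by blast
  then have "4 * (\<alpha> + b * \<gamma>) = 0"
    unfolding d \<open>\<zeta> = 0\<close> by (simp add: algebra_simps)
  then have "\<alpha> + b * \<gamma> = 0" by (simp only: mult_eq_0_iff) simp
  then have "\<alpha> = - b * \<gamma>" by simp
  with \<open>\<zeta> = 0\<close> \<open>\<epsilon> = 0\<close> \<open>\<beta> = 0\<close> d show ?thesis by blast
qed

text \<open>A quadratic polynomial is determined up to a factor by the conic on which it vanishes: every large \<open>t\<close>
is the slope of a point of the conic, so the quartic of \<open>vertex_conic_slope_form\<close> has infinitely many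
roots.\<close>

lemma quadratic_vanishing_on_vertex_conic:
  fixes b \<alpha> \<beta> \<gamma> \<delta> \<epsilon> \<zeta> :: real
  assumes van: "\<And>x y. y\<^sup>2 = 2 * x + b * x\<^sup>2 \<Longrightarrow>
      \<alpha> * x\<^sup>2 + \<beta> * x * y + \<gamma> * y\<^sup>2 + \<delta> * x + \<epsilon> * y + \<zeta> = 0"
  shows "\<alpha> = - b * \<gamma> \<and> \<beta> = 0 \<and> \<delta> = - 2 * \<gamma> \<and> \<epsilon> = 0 \<and> \<zeta> = 0"
proof -
  let ?c0 = "4 * \<alpha> - 2 * b * \<delta> + b\<^sup>2 * \<zeta>" and ?c1 = "4 * \<beta> - 2 * b * \<epsilon>"
    and ?c2 = "4 * \<gamma> + 2 * \<delta> - 2 * b * \<zeta>"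
  let ?p = "[:?c0, ?c1, ?c2, 2 * \<epsilon>, \<zeta>:]"
  have "poly ?p t = 0" if "t > sqrt \<bar>b\<bar>" for t
  proof -
    have "(sqrt \<bar>b\<bar>)\<^sup>2 < t\<^sup>2" using that by (intro power_strict_mono) auto
    then have pos: "t\<^sup>2 - b > 0" by auto
    define x where "x = 2 / (t\<^sup>2 - b)"
    have ne: "t\<^sup>2 - b \<noteq> 0" using pos by linarith
    have x: "x \<noteq> 0" "x * (t\<^sup>2 - b) = 2"
      using ne by (simp add: x_def, intro nonzero_eq_divide_eq[OF ne, THEN iffD1] x_def)
    have "(t * x)\<^sup>2 = (x * (t\<^sup>2 - b)) * x + b * x\<^sup>2"
      by (simp add: power2_eq_square algebra_simps)
    then have on: "(t * x)\<^sup>2 = 2 * x + b * x\<^sup>2" by (simp only: x)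
    have t: "t * x / x = t" using x by simp
    have "poly ?p t = \<zeta> * t ^ 4 + 2 * \<epsilon> * t ^ 3 + ?c2 * t\<^sup>2 + ?c1 * t + ?c0"
      by (simp add: algebra_simps eval_nat_numeral)
    also have "\<dots> = 0"
      using vertex_conic_slope_form(2)[OF x(1) on, of \<zeta> \<epsilon> \<gamma> \<delta> \<beta> \<alpha>]
      unfolding t van[OF on] by simp
    finally show ?thesis .
  qed
  then have "{sqrt \<bar>b\<bar><..} \<subseteq> {t. poly ?p t = 0}" by auto
  moreover have "infinite {sqrt \<bar>b\<bar><..}" by (rule infinite_Ioi)
  ultimately have "infinite {t. poly ?p t = 0}" using finite_subset by blast
  then have "?p = 0" using poly_roots_finite by blast
  then have "\<zeta> = 0 \<and> 2 * \<epsilon> = 0 \<and> ?c2 = 0 \<and> ?c1 = 0 \<and> ?c0 = 0"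
    unfolding pCons_eq_0_iff by blast
  then show ?thesis by (rule slope_quartic_zero)
qed

text \<open>The parameter \<open>b'\<close> belongs to an arbitrary conic over \<open>K\<close>, whereas the locale parameter \<open>b\<close> belongs to
the fixed conic that provides the roots of quartics.\<close>

lemma (in conic_circle_closed) conic_meets_quadratic_mem:
  assumes K: "b' \<in> K" "\<alpha> \<in> K" "\<beta> \<in> K" "\<gamma> \<in> K" "\<delta> \<in> K" "\<epsilon> \<in> K" "\<zeta> \<in> K"
    and on: "y\<^sup>2 = 2 * x + b' * x\<^sup>2"
    and root: "\<alpha> * x\<^sup>2 + \<beta> * x * y + \<gamma> * y\<^sup>2 + \<delta> * x + \<epsilon> * y + \<zeta> = 0"
    and nprop: "\<not> (\<alpha> = - b' * \<gamma> \<and> \<beta> = 0 \<and> \<delta> = - 2 * \<gamma> \<and> \<epsilon> = 0 \<and> \<zeta> = 0)"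
  shows "x \<in> K \<and> y \<in> K"
proof (cases "x = 0")
  case True
  with on have "y = 0" by simp
  with True show ?thesis by (simp add: zero_mem)
next
  case False
  define t where "t = y / x"
  note slope = vertex_conic_slope_form[OF False on, folded t_def]
  have "\<zeta> * t ^ 4 + 2 * \<epsilon> * t ^ 3 + (4 * \<gamma> + 2 * \<delta> - 2 * b' * \<zeta>) * t\<^sup>2
      + (4 * \<beta> - 2 * b' * \<epsilon>) * t + (4 * \<alpha> - 2 * b' * \<delta> + b'\<^sup>2 * \<zeta>) = 0"
    unfolding slope(2) root by simp
  then have t: "t \<in> K"
    by (rule quartic_root_mem[rotated -1])
      ((intro mem_rules K)+, use nprop slope_quartic_zero in blast)
  have "t\<^sup>2 - b' \<noteq> 0" using slope(1) by auto
  then have "x = 2 / (t\<^sup>2 - b')" using slope(1) by (simp add: nonzero_eq_divide_eq)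
  also have "\<dots> \<in> K" by (intro mem_rules K t)
  finally have x: "x \<in> K" .
  have "y = t * x" using False by (simp add: t_def)
  then show ?thesis using x t by (simp only: mult_mem)
qed

text \<open>The similarities between two conics in normal form are the identity and, if the conic has a centre, the
point reflection in it. The case to exclude is a similarity that turns by a right angle; comparing
coefficients, it would force \<open>b b' = 1\<close> with \<open>b > 0\<close>, and \<open>b (Im p)\<^sup>2 = -1\<close>.\<close>

lemma similar_vertex_conics:
  fixes p n :: complex
  assumes b: "b > -1" "b' > -1"
    and sim: "\<And>w. w \<in> vertex_conic b' \<Longrightarrow> p + n * w \<in> vertex_conic b" and n: "n \<noteq> 0"
  shows "b' = b \<and> (p = 0 \<and> n = 1 \<or> p = of_real (- 2 / b) \<and> n = -1)"
proof -
  define p1 p2 n1 n2 where defs: "p1 = Re p" "p2 = Im p" "n1 = Re n" "n2 = Im n"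
  define \<gamma> where "\<gamma> = n1\<^sup>2 - b * n2\<^sup>2"
  have nn: "n1 \<noteq> 0 \<or> n2 \<noteq> 0" using n by (auto simp: defs complex_eq_iff)
  have "(n2\<^sup>2 - b * n1\<^sup>2) * x\<^sup>2 + (2 * (1 + b) * (n1 * n2)) * x * y + \<gamma> * y\<^sup>2
      + (2 * p2 * n2 - 2 * n1 - 2 * b * p1 * n1) * x
      + (2 * p2 * n1 + 2 * n2 + 2 * b * p1 * n2) * y + (p2\<^sup>2 - 2 * p1 - b * p1\<^sup>2) = 0"
    if "y\<^sup>2 = 2 * x + b' * x\<^sup>2" for x y
  proof -
    have "p + n * Complex x y \<in> vertex_conic b"
      using that by (intro sim) (simp add: vertex_conic_def)
    then have "(p2 + (n1 * y + n2 * x))\<^sup>2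
        - (2 * (p1 + (n1 * x - n2 * y)) + b * (p1 + (n1 * x - n2 * y))\<^sup>2) = 0"
      by (simp add: vertex_conic_def defs)
    then show ?thesis
      by (simp add: \<gamma>_def power2_eq_square algebra_simps)
  qed
  \<comment> \<open>the equation of the second conic, pulled back, is a multiple (by \<open>\<gamma>\<close>) of that of the first\<close>
  from quadratic_vanishing_on_vertex_conic[OF this]
  have xx: "n2\<^sup>2 - b * n1\<^sup>2 = - b' * \<gamma>" and xy: "2 * (1 + b) * (n1 * n2) = 0"
    and x: "2 * p2 * n2 - 2 * n1 - 2 * b * p1 * n1 = - 2 * \<gamma>"
    and y: "2 * p2 * n1 + 2 * n2 + 2 * b * p1 * n2 = 0"
    and c: "p2\<^sup>2 - 2 * p1 - b * p1\<^sup>2 = 0"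
    by blast+
  from xy b have "n1 = 0 \<or> n2 = 0" by auto
  moreover have "n1 \<noteq> 0"
  proof
    assume n1: "n1 = 0"
    with nn have n2: "n2 \<noteq> 0" by simp
    have \<gamma>: "\<gamma> = - b * n2\<^sup>2" by (simp add: \<gamma>_def n1)
    have "n2\<^sup>2 * 1 = n2\<^sup>2 * (b * b')" using xx by (simp add: \<gamma> n1 mult.commute)
    then have "1 = b * b'" using n2 unfolding mult_cancel_left by simp
    then have bb: "b * b' = 1" by (rule sym)
    have "b > 0"
    proof (rule ccontr)
      assume "\<not> b > 0"
      moreover from this have "b' < 0"
        using bb mult_nonpos_nonneg[of b b'] by linarith
      ultimately have "(- b) * (- b') < 1 * 1"
        using b by (intro mult_strict_mono) auto
      with bb show False by simp
    qed
    have "n2 * p2 = n2 * (b * n2)" using x by (simp add: \<gamma> n1 power2_eq_square)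
    then have p2: "p2 = b * n2" using n2 by simp
    have "n2 * (1 + b * p1) = 0" using y by (simp add: n1 algebra_simps)
    then have bp: "b * p1 = -1" using n2 by simp
    have "0 = b * (p2\<^sup>2 - 2 * p1 - b * p1\<^sup>2)" using c by simp
    also have "\<dots> = b * p2\<^sup>2 - 2 * (b * p1) - (b * p1)\<^sup>2"
      by (simp add: power2_eq_square algebra_simps)
    also have "\<dots> = b * p2\<^sup>2 + 1" by (simp add: bp)
    finally have "b * p2\<^sup>2 = -1" by simp
    moreover have "b * p2\<^sup>2 \<ge> 0" using \<open>b > 0\<close> by simp
    ultimately show False by linarith
  qed
  ultimately have n2: "n2 = 0" and n1: "n1 \<noteq> 0" by blast+
  have \<gamma>: "\<gamma> = n1\<^sup>2" by (simp add: \<gamma>_def n2)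
  have b': "b' = b" using xx n1 by (simp add: \<gamma> n2)
  have p2: "p2 = 0" using y n1 by (simp add: n2)
  have "n1 * (1 + b * p1) = n1 * n1" using x by (simp add: \<gamma> n2 power2_eq_square algebra_simps)
  then have n1': "n1 = 1 + b * p1" using n1 by simp
  have "p1 * (2 + b * p1) = 0" using c by (simp add: p2 power2_eq_square algebra_simps)
  then consider "p1 = 0" | "b * p1 = -2" by auto
  then have "p1 = 0 \<and> n1 = 1 \<or> p1 = - 2 / b \<and> n1 = -1"
  proof cases
    case 2
    then have "b \<noteq> 0" by auto
    then have "p1 = (b * p1) / b" by simp
    then have "p1 = - 2 / b" by (simp only: 2)
    with 2 n1' show ?thesis by simp
  qed (use n1' in simp)
  then show ?thesis
    using b' p2 n2 by (auto simp: complex_eq_iff defs)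
qed

lemma euclidean_subfield_UNIV: "euclidean_subfield UNIV"
  by unfold_locales auto

text \<open>Two focus-directrix descriptions of the same conic give two normal forms of it, related by one of
the similarities of \<open>similar_vertex_conics\<close>; these leave two candidates for the focus.\<close>

lemma finite_foci:
  assumes "conic_with S f l e"
  shows "finite (foci S)"
proof -
  have form: "\<exists>p m. m \<noteq> 0 \<and> f = p + m / of_real (1 + e) \<and>
      (\<forall>w. p + m * w \<in> S \<longleftrightarrow> w \<in> vertex_conic (e\<^sup>2 - 1))"
    if "conic_with S f l e" for f l e
  proof -
    have P: "plane_over UNIV = UNIV" by (simp add: plane_over_def)
    have L: "l \<in> lines_through (plane_over UNIV)" using that by (simp add: P conic_with_def)
    show ?thesis
      by (rule euclidean_subfield.conic_normal_form[OF euclidean_subfield_UNIV that _ L UNIV_I])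
        (simp add: P, blast)
  qed
  obtain p m where m: "m \<noteq> 0" and S: "\<And>w. p + m * w \<in> S \<longleftrightarrow> w \<in> vertex_conic (e\<^sup>2 - 1)"
    using form[OF assms] by blast
  have e: "e > 0" using assms by (simp add: conic_with_def)
  \<comment> \<open>twice the centre of the conic in normal form (zero for a parabola, as division by zero is zero)\<close>
  define c :: complex where "c = of_real (- 2 / (e\<^sup>2 - 1))"
  have "foci S \<subseteq> {p + m * (1 / of_real (1 + e)), p + m * (c - 1 / of_real (1 + e))}"
  proof
    fix f' assume "f' \<in> foci S"
    then obtain l' e' where c': "conic_with S f' l' e'" by (auto simp: foci_def)
    then have e': "e' > 0" by (simp add: conic_with_def)
    obtain p' m' where m': "m' \<noteq> 0" "f' = p' + m' / of_real (1 + e')"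
      and S': "\<And>w. p' + m' * w \<in> S \<longleftrightarrow> w \<in> vertex_conic (e'\<^sup>2 - 1)"
      using form[OF c'] by blast
    define x where "x = (p' - p) / m"
    define y where "y = m' / m"
    have x: "p' = p + m * x" and y: "m' = m * y" using m by (simp_all add: x_def y_def)
    have sim: "x + y * w \<in> vertex_conic (e\<^sup>2 - 1)" if "w \<in> vertex_conic (e'\<^sup>2 - 1)" for w
    proof -
      have "p + m * (x + y * w) = p' + m' * w" by (simp add: x y algebra_simps)
      then show ?thesis using that S[of "x + y * w"] S'[of w] by simp
    qed
    have "e\<^sup>2 - 1 > -1" "e'\<^sup>2 - 1 > -1" "y \<noteq> 0" using e e' m m' by (simp_all add: y_def)
    from similar_vertex_conics[OF this(1,2) sim this(3)]
    have "e'\<^sup>2 - 1 = e\<^sup>2 - 1" and xy: "x = 0 \<and> y = 1 \<or> x = c \<and> y = -1"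
      unfolding c_def by blast+
    then have e'_eq: "e' = e" using e e' by (simp add: power2_eq_iff_nonneg)
    from xy consider "p' = p" "m' = m" | "p' = p + m * c" "m' = - m"
      unfolding x y by auto
    then show "f' \<in> {p + m * (1 / of_real (1 + e)), p + m * (c - 1 / of_real (1 + e))}"
      by cases (auto simp: m'(2) e'_eq algebra_simps)
  qed
  then show ?thesis by (rule finite_subset) simp
qed

section \<open>Quadratic curves in the plane\<close>

text \<open>The general real quadratic polynomial in the coordinates of \<open>z\<close>. Written with complex coefficients
it transforms under similarities \<open>w \<mapsto> p + m w\<close> by a short formula.\<close>

definition quadric :: "complex \<Rightarrow> real \<Rightarrow> complex \<Rightarrow> real \<Rightarrow> complex \<Rightarrow> real" where
  "quadric A r B s z = Re (A * z\<^sup>2) + r * (norm z)\<^sup>2 + Re (B * z) + s"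

text \<open>The condition \<open>S \<noteq> UNIV\<close> excludes the zero polynomial.\<close>

definition quadratic_curve :: "real set \<Rightarrow> complex set \<Rightarrow> bool" where
  "quadratic_curve K S \<longleftrightarrow> S \<noteq> UNIV \<and>
     (\<exists>A\<in>plane_over K. \<exists>r\<in>K. \<exists>B\<in>plane_over K. \<exists>s\<in>K. S = {z. quadric A r B s z = 0})"

lemma quadric_coordinates:
  "quadric A r B s w = (Re A + r) * (Re w)\<^sup>2 + (- 2 * Im A) * Re w * Im w + (r - Re A) * (Im w)\<^sup>2
     + Re B * Re w + (- Im B) * Im w + s"
  unfolding quadric_def cmod_power2 by (simp add: power2_eq_square algebra_simps)

lemma quadric_similarity:
  "quadric A r B s (p + m * w) = quadric (A * m\<^sup>2) (r * (norm m)\<^sup>2)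
     (2 * A * p * m + 2 * of_real r * cnj p * m + B * m) (quadric A r B s p) w"
  unfolding quadric_def cmod_power2 by (simp add: power2_eq_square algebra_simps)

context euclidean_subfield
begin

lemma quadric_mem:
  assumes "A \<in> plane_over K" "r \<in> K" "B \<in> plane_over K" "s \<in> K" "z \<in> plane_over K"
  shows "quadric A r B s z \<in> K"
  unfolding quadric_def using assms by (intro mem_rules Re_mem plane_over_rules norm_mem)

lemma quadratic_curve_vimage:
  assumes S: "quadratic_curve K S" and p: "p \<in> plane_over K" and m: "m \<in> plane_over K" "m \<noteq> 0"
  shows "quadratic_curve K ((\<lambda>w. p + m * w) -` S)"
proof -
  obtain A r B s where K: "A \<in> plane_over K" "r \<in> K" "B \<in> plane_over K" "s \<in> K"
    and S': "S = {z. quadric A r B s z = 0}" and ne: "S \<noteq> UNIV"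
    using S unfolding quadratic_curve_def by blast
  have "(\<lambda>w. p + m * w) -` S \<noteq> UNIV"
  proof -
    obtain z where "z \<notin> S" using ne by blast
    moreover have "p + m * ((z - p) / m) = z" using m by simp
    ultimately have "(z - p) / m \<notin> (\<lambda>w. p + m * w) -` S" by (simp only: vimage_eq) simp
    then show ?thesis by blast
  qed
  moreover have "(\<lambda>w. p + m * w) -` S = {w. quadric (A * m\<^sup>2) (r * (norm m)\<^sup>2)
     (2 * A * p * m + 2 * of_real r * cnj p * m + B * m) (quadric A r B s p) w = 0}"
    unfolding S' vimage_def mem_Collect_eq quadric_similarity ..
  moreover have "A * m\<^sup>2 \<in> plane_over K" "r * (norm m)\<^sup>2 \<in> K"
    "2 * A * p * m + 2 * of_real r * cnj p * m + B * m \<in> plane_over K" "quadric A r B s p \<in> K"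
    by (intro mem_rules norm_mem quadric_mem plane_over_rules K m p)+
  ultimately show ?thesis unfolding quadratic_curve_def by blast
qed

lemma quadratic_curve_line:
  assumes "S \<in> lines_through (plane_over K)"
  shows "quadratic_curve K S"
proof -
  obtain a b where ab: "a \<in> plane_over K" "b \<in> plane_over K" "a \<noteq> b" and S: "S = affine hull {a, b}"
    using assms by (auto simp: lines_through_def)
  have "a + \<i> * (b - a) \<notin> S"
    using ab(3) by (simp add: S mem_line_iff)
  then have "S \<noteq> UNIV" by blast
  moreover have "S = {z. quadric 0 0 (- \<i> / (b - a)) (Im (- a / (b - a))) z = 0}"
  proof -
    have "Im ((z - a) / (b - a)) = quadric 0 0 (- \<i> / (b - a)) (Im (- a / (b - a))) z" for z
    proof -
      have "(z - a) / (b - a) = z / (b - a) + - a / (b - a)"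
        by (simp add: diff_divide_distrib)
      moreover have "Im (z / (b - a)) = Re (- \<i> / (b - a) * z)"
      proof -
        have "- \<i> / (b - a) * z = - (\<i> * (z / (b - a)))" by simp
        then show ?thesis by (simp only: uminus_complex.sel Re_i_times minus_minus)
      qed
      ultimately show ?thesis by (simp add: quadric_def)
    qed
    then show ?thesis by (auto simp: S mem_line_iff[OF ab(3)])
  qed
  moreover have "- \<i> / (b - a) \<in> plane_over K" "Im (- a / (b - a)) \<in> K"
    by (intro plane_over_rules Im_mem ab)+
  ultimately show ?thesis
    unfolding quadratic_curve_def using plane_over_constants(3) zero_mem by blast
qed

lemma quadratic_curve_circle:
  assumes "S \<in> drawn_circles (plane_over K)"
  shows "quadratic_curve K S"
proof -
  obtain a b where ab: "a \<in> plane_over K" "b \<in> plane_over K" "a \<noteq> b" and S: "S = sphere a (dist a b)"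
    using assms by (auto simp: drawn_circles_def)
  have "a \<notin> S" using ab(3) by (simp add: S)
  then have "S \<noteq> UNIV" by blast
  moreover have "S = {z. quadric 0 1 (- 2 * cnj a) ((norm a)\<^sup>2 - (norm (b - a))\<^sup>2) z = 0}"
  proof -
    have "z \<in> S \<longleftrightarrow> quadric 0 1 (- 2 * cnj a) ((norm a)\<^sup>2 - (norm (b - a))\<^sup>2) z = 0" for z
    proof -
      have "z \<in> S \<longleftrightarrow> norm (z - a) = norm (b - a)"
        by (auto simp: S dist_norm norm_minus_commute)
      also have "\<dots> \<longleftrightarrow> (norm (z - a))\<^sup>2 = (norm (b - a))\<^sup>2"
        by (simp only: power2_eq_iff_nonneg norm_ge_zero)
      also have "(norm (z - a))\<^sup>2 = quadric 0 1 (- 2 * cnj a) ((norm a)\<^sup>2) z"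
        unfolding quadric_def cmod_power2 by (simp add: power2_eq_square algebra_simps)
      finally show ?thesis by (auto simp: quadric_def)
    qed
    then show ?thesis by blast
  qed
  moreover have "- 2 * cnj a \<in> plane_over K" "(norm a)\<^sup>2 - (norm (b - a))\<^sup>2 \<in> K"
    by (intro mem_rules plane_over_rules norm_mem ab)+
  ultimately show ?thesis
    unfolding quadratic_curve_def using plane_over_rules(4) zero_mem one_mem by blast
qed

lemma quadratic_curve_vertex_conic:
  assumes "b \<in> K"
  shows "quadratic_curve K (vertex_conic b)"
proof -
  have "\<i> \<notin> vertex_conic b" by (simp add: vertex_conic_def)
  then have "vertex_conic b \<noteq> UNIV" by blast
  moreover have "vertex_conic b
      = {w. quadric (of_real (- (1 + b) / 2)) ((1 - b) / 2) (- 2) 0 w = 0}"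
    unfolding quadric_coordinates vertex_conic_def by (auto simp: field_simps)
  moreover have "of_real (- (1 + b) / 2) \<in> plane_over K" "(1 - b) / 2 \<in> K" "- 2 \<in> plane_over K"
    by (intro mem_rules plane_over_of_real plane_over_minus plane_over_constants assms)+
  ultimately show ?thesis
    unfolding quadratic_curve_def using zero_mem by blast
qed

text \<open>The equation of the normal form is pulled back along the inverse of the similarity that produces it.\<close>

lemma quadratic_curve_conic:
  assumes "conic_with S f l e" and f: "f \<in> plane_over K" and l: "l \<in> lines_through (plane_over K)"
    and e: "e \<in> K"
  shows "quadratic_curve K S"
proof -
  obtain p m where K: "p \<in> plane_over K" "m \<in> plane_over K" and m: "m \<noteq> 0"
    and "f = p + m / of_real (1 + e)"
    and S: "\<And>w. p + m * w \<in> S \<longleftrightarrow> w \<in> vertex_conic (e\<^sup>2 - 1)"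
    by (rule conic_normal_form[OF assms]) (rule that; blast)
  have "quadratic_curve K (vertex_conic (e\<^sup>2 - 1))"
    by (intro quadratic_curve_vertex_conic mem_rules e)
  then have "quadratic_curve K ((\<lambda>z. - p / m + 1 / m * z) -` vertex_conic (e\<^sup>2 - 1))"
    by (rule quadratic_curve_vimage) (use m in \<open>auto intro!: plane_over_rules K\<close>)
  moreover have "z \<in> S \<longleftrightarrow> - p / m + 1 / m * z \<in> vertex_conic (e\<^sup>2 - 1)" for z
  proof -
    have "p + m * (- p / m + 1 / m * z) = z" using m by (simp add: field_simps)
    then show ?thesis using S[of "- p / m + 1 / m * z"] by simp
  qed
  then have "S = (\<lambda>z. - p / m + 1 / m * z) -` vertex_conic (e\<^sup>2 - 1)" by blast
  ultimately show ?thesis by simp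
qed

end

text \<open>In the normal form of \<open>S\<close> this is \<open>conic_meets_quadratic_mem\<close>. The exceptional case of that lemma says
that the polynomial of \<open>T\<close> is a multiple of the polynomial of \<open>S\<close>: for a nonzero factor the curves are
equal, for the factor zero \<open>T\<close> is the whole plane.\<close>

lemma (in conic_circle_closed) conic_meets_quadratic_curve:
  assumes S: "conic_with S f l e" "f \<in> plane_over K" "l \<in> lines_through (plane_over K)" "e \<in> K"
    and T: "quadratic_curve K T" and "S \<noteq> T" and z: "z \<in> S" "z \<in> T"
  shows "z \<in> plane_over K"
proof -
  obtain p m where K: "p \<in> plane_over K" "m \<in> plane_over K" and m: "m \<noteq> 0"
    and "f = p + m / of_real (1 + e)"
    and S: "\<And>w. p + m * w \<in> S \<longleftrightarrow> w \<in> vertex_conic (e\<^sup>2 - 1)"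
    by (rule conic_normal_form[OF S]) (rule that; blast)
  let ?T = "(\<lambda>w. p + m * w) -` T"
  define w where "w = (z - p) / m"
  have inv: "p + m * ((u - p) / m) = u" for u using m by simp
  have zw: "p + m * w = z" unfolding w_def by (rule inv)
  have w: "w \<in> vertex_conic (e\<^sup>2 - 1)" "w \<in> ?T"
    using z S[of w] by (simp_all add: zw)
  have neq: "?T \<noteq> vertex_conic (e\<^sup>2 - 1)"
  proof
    assume "?T = vertex_conic (e\<^sup>2 - 1)"
    then have TS: "p + m * u \<in> T \<longleftrightarrow> p + m * u \<in> S" for u using S by blast
    have "u \<in> T \<longleftrightarrow> u \<in> S" for u using TS[of "(u - p) / m"] unfolding inv .
    then have "T = S" by blast
    with \<open>S \<noteq> T\<close> show False by simp
  qed
  have "quadratic_curve K ?T" by (rule quadratic_curve_vimage[OF T K m])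
  then obtain A r B s where Q: "A \<in> plane_over K" "r \<in> K" "B \<in> plane_over K" "s \<in> K"
    and ne: "?T \<noteq> UNIV" and T': "?T = {z. quadric A r B s z = 0}"
    unfolding quadratic_curve_def by (elim conjE bexE) (rule that)
  let ?b = "e\<^sup>2 - 1"
  have "Re w \<in> K \<and> Im w \<in> K"
  proof (rule conic_meets_quadratic_mem)
    show "?b \<in> K" by (intro mem_rules assms)
    show "Re A + r \<in> K" "- 2 * Im A \<in> K" "r - Re A \<in> K" "Re B \<in> K" "- Im B \<in> K" "s \<in> K"
      by (intro mem_rules Re_mem Im_mem minus_mem[OF numeral_mem] minus_mem Q)+
    show "(Im w)\<^sup>2 = 2 * Re w + ?b * (Re w)\<^sup>2" using w(1) by (simp add: vertex_conic_def)
    show "(Re A + r) * (Re w)\<^sup>2 + (- 2 * Im A) * Re w * Im w + (r - Re A) * (Im w)\<^sup>2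
        + Re B * Re w + (- Im B) * Im w + s = 0"
      using w(2) unfolding T' mem_Collect_eq quadric_coordinates .
    show "\<not> (Re A + r = - ?b * (r - Re A) \<and> - 2 * Im A = 0 \<and> Re B = - 2 * (r - Re A)
        \<and> - Im B = 0 \<and> s = 0)"
    proof
      assume pr: "Re A + r = - ?b * (r - Re A) \<and> - 2 * Im A = 0 \<and> Re B = - 2 * (r - Re A)
        \<and> - Im B = 0 \<and> s = 0"
      have q: "quadric A r B s u = (r - Re A) * ((Im u)\<^sup>2 - (2 * Re u + ?b * (Re u)\<^sup>2))" for u
      proof -
        have "Re A + r = - ?b * (r - Re A)" "- 2 * Im A = 0" "Re B = - 2 * (r - Re A)"
          "- Im B = 0" "s = 0" using pr by blast+
        then have "quadric A r B s u = - ?b * (r - Re A) * (Re u)\<^sup>2 + 0 * Re u * Im u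
            + (r - Re A) * (Im u)\<^sup>2 + - 2 * (r - Re A) * Re u + 0 * Im u + 0"
          unfolding quadric_coordinates by (simp only:)
        then show ?thesis by (simp add: algebra_simps)
      qed
      show False
      proof (cases "r - Re A = 0")
        case True
        then have "?T = UNIV" unfolding T' q by simp
        with ne show False ..
      next
        case False
        then have "?T = vertex_conic ?b" unfolding T' q vertex_conic_def by simp
        with neq show False ..
      qed
    qed
  qed
  then have "w \<in> plane_over K" by (simp add: plane_over_def)
  then have "p + m * w \<in> plane_over K" by (intro plane_over_rules K)
  then show ?thesis unfolding zw .
qed

section \<open>Points obtained by ruler and compass\<close>

locale ruler_compass_closed =
  fixes M :: "complex set"
  assumes zero_pt: "0 \<in> M" and one_pt: "1 \<in> M"
    and meet_pt: "\<lbrakk>S \<in> lines_through M \<union> drawn_circles M; T \<in> lines_through M \<union> drawn_circles M;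
       S \<noteq> T; z \<in> S; z \<in> T\<rbrakk> \<Longrightarrow> z \<in> M"
begin

text \<open>In this and the next two lemmas the assumption \<open>distinct\<close> exhibits a point that lies on one of the
curves only.\<close>

lemma line_meets_line:
  assumes "a \<in> M" "b \<in> M" "c \<in> M" "d \<in> M" "a \<noteq> b" "c \<noteq> d"
    and z: "Im ((z - a) / (b - a)) = 0" "Im ((z - c) / (d - c)) = 0"
    and distinct: "Im ((a - c) / (d - c)) \<noteq> 0"
  shows "z \<in> M"
proof (rule meet_pt)
  show "affine hull {a, b} \<in> lines_through M \<union> drawn_circles M"
    "affine hull {c, d} \<in> lines_through M \<union> drawn_circles M"
    using assms by (auto simp: lines_through_def)
  have "a \<in> affine hull {a, b}" by (simp add: hull_inc)
  moreover have "a \<notin> affine hull {c, d}" using distinct assms by (simp add: mem_line_iff)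
  ultimately show "affine hull {a, b} \<noteq> affine hull {c, d}" by blast
  show "z \<in> affine hull {a, b}" "z \<in> affine hull {c, d}"
    using assms by (simp_all add: mem_line_iff)
qed

lemma line_meets_circle:
  assumes "a \<in> M" "b \<in> M" "c \<in> M" "d \<in> M" "a \<noteq> b" "c \<noteq> d"
    and z: "Im ((z - a) / (b - a)) = 0" "norm (z - c) = norm (d - c)"
    and distinct: "Im ((x - a) / (b - a)) = 0 \<longleftrightarrow> norm (x - c) \<noteq> norm (d - c)"
  shows "z \<in> M"
proof (rule meet_pt)
  show "affine hull {a, b} \<in> lines_through M \<union> drawn_circles M"
    "sphere c (dist c d) \<in> lines_through M \<union> drawn_circles M"
    using assms by (auto simp: lines_through_def drawn_circles_def)
  have sphere: "u \<in> sphere c (dist c d) \<longleftrightarrow> norm (u - c) = norm (d - c)" for u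
    by (auto simp: dist_norm norm_minus_commute)
  have "x \<in> affine hull {a, b} \<longleftrightarrow> x \<notin> sphere c (dist c d)"
    using distinct unfolding mem_line_iff[OF assms(5)] sphere .
  then show "affine hull {a, b} \<noteq> sphere c (dist c d)" by blast
  show "z \<in> affine hull {a, b}" "z \<in> sphere c (dist c d)"
    using z unfolding mem_line_iff[OF assms(5)] sphere .
qed

lemma circle_meets_circle:
  assumes "a \<in> M" "b \<in> M" "c \<in> M" "d \<in> M" "a \<noteq> b" "c \<noteq> d"
    and z: "norm (z - a) = norm (b - a)" "norm (z - c) = norm (d - c)"
    and distinct: "norm (x - a) = norm (b - a)" "norm (x - c) \<noteq> norm (d - c)"
  shows "z \<in> M"
proof (rule meet_pt)
  show "sphere a (dist a b) \<in> lines_through M \<union> drawn_circles M"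
    "sphere c (dist c d) \<in> lines_through M \<union> drawn_circles M"
    using assms by (auto simp: drawn_circles_def)
  have sphere: "u \<in> sphere c (dist c d) \<longleftrightarrow> norm (u - c) = norm (d - c)" for u c d :: complex
    by (auto simp: dist_norm norm_minus_commute)
  have "x \<in> sphere a (dist a b)" "x \<notin> sphere c (dist c d)"
    using distinct unfolding sphere by simp_all
  then show "sphere a (dist a b) \<noteq> sphere c (dist c d)" by blast
  show "z \<in> sphere a (dist a b)" "z \<in> sphere c (dist c d)"
    using z unfolding sphere by simp_all
qed

lemma point_reflection_pt:
  assumes "a \<in> M" "b \<in> M"
  shows "2 * a - b \<in> M"
proof (cases "a = b")
  case False
  have "(2 * a - b - a) / (b - a) = - ((b - a) / (b - a))" by (simp add: field_simps)
  also have "\<dots> = -1" using False by simp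
  finally have on_line: "Im ((2 * a - b - a) / (b - a)) = 0" by simp
  have "2 * a - b - a = a - b" by simp
  then have on_circle: "norm (2 * a - b - a) = norm (b - a)" by (simp only: norm_minus_commute)
  have "Im ((a - a) / (b - a)) = 0 \<longleftrightarrow> norm (a - a) \<noteq> norm (b - a)" using False by simp
  from line_meets_circle[OF assms assms False False on_line on_circle this] show ?thesis .
qed (use assms in simp)

text \<open>The two circles centred at one endpoint of a segment and passing through the other meet at the
apexes of the equilateral triangles on the segment.\<close>

lemma equilateral_pt:
  assumes "a \<in> M" "b \<in> M" "a \<noteq> b" and \<sigma>: "\<sigma> = sqrt 3 \<or> \<sigma> = - sqrt 3"
  shows "a + (b - a) * Complex (1 / 2) (\<sigma> / 2) \<in> M"
proof (rule circle_meets_circle[of a b b a _ b])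
  have n: "norm (Complex (1 / 2) (\<sigma> / 2)) = 1" "norm (Complex (- 1 / 2) (\<sigma> / 2)) = 1"
    using \<sigma> by (auto simp: cmod_def power_divide)
  show "norm (a + (b - a) * Complex (1 / 2) (\<sigma> / 2) - a) = norm (b - a)"
    by (simp add: norm_mult n)
  have "a + (b - a) * Complex (1 / 2) (\<sigma> / 2) - b = (b - a) * Complex (- 1 / 2) (\<sigma> / 2)"
    by (simp add: complex_eq_iff algebra_simps)
  then show "norm (a + (b - a) * Complex (1 / 2) (\<sigma> / 2) - b) = norm (a - b)"
    by (simp only: norm_mult n norm_minus_commute)
qed (use assms in auto)

text \<open>The line through the two apexes of \<open>equilateral_pt\<close> is the perpendicular bisector.\<close>

lemma midpoint_pt:
  assumes "a \<in> M" "b \<in> M"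
  shows "(a + b) / 2 \<in> M"
proof (cases "a = b")
  case False
  define c where "c = a + (b - a) * Complex (1 / 2) (sqrt 3 / 2)"
  define d where "d = a + (b - a) * Complex (1 / 2) (- sqrt 3 / 2)"
  have cd: "c \<in> M" "d \<in> M"
    unfolding c_def d_def using assms False by (intro equilateral_pt; simp)+
  have dc: "d - c = (b - a) * (- \<i> * of_real (sqrt 3))"
    unfolding c_def d_def by (simp add: complex_eq_iff algebra_simps)
  have "(a + b) / 2 - a = (b - a) * (1 / 2)" by (simp add: field_simps)
  then have 1: "((a + b) / 2 - a) / (b - a) = 1 / 2" using False by simp
  have "(a + b) / 2 - c = (b - a) * (- \<i> * of_real (sqrt 3) * of_real (1 / 2))"
    unfolding c_def by (simp add: complex_eq_iff field_simps)
  then have 2: "((a + b) / 2 - c) / (d - c) = of_real (1 / 2)"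
    unfolding dc using False by simp
  have ac: "a - c = (b - a) * - Complex (1 / 2) (sqrt 3 / 2)"
    unfolding c_def by simp
  have "(a - c) / (d - c) = - Complex (1 / 2) (sqrt 3 / 2) / (- \<i> * of_real (sqrt 3))"
    unfolding ac dc using False by (simp only: mult_divide_mult_cancel_left right_minus_eq)
  then have 3: "Im ((a - c) / (d - c)) \<noteq> 0"
    by (simp add: Im_divide)
  have "d - c \<noteq> 0" unfolding dc using False by simp
  then have "c \<noteq> d" by auto
  moreover have "Im (((a + b) / 2 - a) / (b - a)) = 0" unfolding 1 by simp
  moreover have "Im (((a + b) / 2 - c) / (d - c)) = 0" unfolding 2 by simp
  ultimately show ?thesis by (rule line_meets_line[OF assms cd False _ _ _ 3])
qed (use assms in simp)

lemma minus_pt: "a \<in> M \<Longrightarrow> - a \<in> M"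
  using point_reflection_pt[OF zero_pt] by simp

lemma add_pt: "\<lbrakk>a \<in> M; b \<in> M\<rbrakk> \<Longrightarrow> a + b \<in> M"
proof -
  assume "a \<in> M" "b \<in> M"
  then have "2 * ((a + b) / 2) - 0 \<in> M" by (intro point_reflection_pt midpoint_pt zero_pt)
  moreover have "2 * ((a + b) / 2) - 0 = a + b" by (simp add: field_simps)
  ultimately show ?thesis by (simp only:)
qed

lemma diff_pt: "\<lbrakk>a \<in> M; b \<in> M\<rbrakk> \<Longrightarrow> a - b \<in> M"
  using add_pt[OF _ minus_pt, of a b] by simp

lemma ii_pt: "\<i> \<in> M"
proof -
  have "- 1 + (1 - - 1) * Complex (1 / 2) (sqrt 3 / 2) \<in> M"
    by (intro equilateral_pt minus_pt one_pt) auto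
  also have "- 1 + (1 - - 1) * Complex (1 / 2) (sqrt 3 / 2) = \<i> * of_real (sqrt 3)"
    by (simp add: complex_eq_iff)
  finally have "\<i> * of_real (sqrt 3) \<in> M" .
  from line_meets_circle[OF zero_pt this zero_pt one_pt, of \<i> 0] show ?thesis
    by (simp add: Im_divide)
qed

text \<open>The circles through \<open>z\<close> with centres \<open>0\<close> and \<open>1\<close> meet again in the mirror image of \<open>z\<close>. They are
different, because \<open>norm z\<close> lies only on the first: it is nearer to \<open>1\<close> than \<open>z\<close> is.\<close>

lemma cnj_pt:
  assumes "z \<in> M"
  shows "cnj z \<in> M"
proof (cases "Im z = 0")
  case True
  then have "cnj z = z" by (simp add: complex_eq_iff)
  then show ?thesis using assms by simp
next
  case False
  have "Re z < norm z"
  proof -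
    have "(Re z)\<^sup>2 < (norm z)\<^sup>2" using False by (simp add: cmod_power2)
    then show ?thesis by (rule power2_less_imp_less) simp
  qed
  then have "(norm z - 1)\<^sup>2 < (norm (z - 1))\<^sup>2"
    unfolding power2_diff[of "norm z"] cmod_power2 by (simp add: power2_diff)
  moreover have "(norm (complex_of_real (norm z) - 1))\<^sup>2 = (norm z - 1)\<^sup>2"
    by (simp add: cmod_power2)
  ultimately have "norm (complex_of_real (norm z) - 1) \<noteq> norm (z - 1)" by auto
  moreover have "norm (cnj z - 1) = norm (z - 1)"
    using complex_mod_cnj[of "z - 1"] by simp
  moreover have "0 \<noteq> z" "1 \<noteq> z" using False by auto
  moreover have "norm (cnj z - 0) = norm (z - 0)" "norm (of_real (norm z) - 0 :: complex) = norm (z - 0)"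
    by simp_all
  ultimately show ?thesis
    using circle_meets_circle[OF zero_pt assms one_pt assms] by blast
qed

lemma Re_pt: "z \<in> M \<Longrightarrow> of_real (Re z) \<in> M"
proof -
  assume "z \<in> M"
  then have "(z + cnj z) / 2 \<in> M" by (intro midpoint_pt cnj_pt)
  moreover have "(z + cnj z) / 2 = of_real (Re z)" by (simp add: complex_add_cnj)
  ultimately show ?thesis by (simp only:)
qed

lemma ii_times_of_real_pt:
  assumes "of_real x \<in> M"
  shows "\<i> * of_real x \<in> M"
proof (cases "x = 0")
  case False
  show ?thesis
    by (rule line_meets_circle[OF zero_pt ii_pt zero_pt assms, where x = 0])
      (use False in \<open>simp_all add: norm_mult Im_divide\<close>)
qed (use zero_pt in simp)

lemma Im_pt:
  assumes "z \<in> M"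
  shows "of_real (Im z) \<in> M"
proof (cases "Im z = 0")
  case False
  have "z - of_real (Re z) \<in> M" by (intro diff_pt Re_pt assms)
  also have "z - of_real (Re z) = \<i> * of_real (Im z)" by (simp add: complex_eq_iff)
  finally have iIm: "\<i> * of_real (Im z) \<in> M" .
  show ?thesis
    by (rule line_meets_circle[OF zero_pt one_pt zero_pt iIm, where x = 0])
      (use False in \<open>simp_all add: norm_mult\<close>)
qed (use zero_pt in simp)

text \<open>Intercept theorem: the line through \<open>\<i> y\<close> parallel to the line through \<open>\<i>\<close> and \<open>x\<close> meets the real axis
in \<open>x y\<close>.\<close>

lemma mult_of_real_pt:
  assumes "of_real x \<in> M" "of_real y \<in> M"
  shows "of_real (x * y) \<in> M"
proof (cases "y = 0")
  case False
  define d where "d = \<i> * of_real y + (of_real x - \<i>)"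
  have "of_real (x * y) - \<i> * of_real y = of_real y * (of_real x - \<i>)" by (simp add: algebra_simps)
  moreover have ne: "of_real x - \<i> \<noteq> 0" by (simp add: complex_eq_iff)
  ultimately have "(of_real (x * y) - \<i> * of_real y) / (d - \<i> * of_real y) = of_real y"
    by (simp add: d_def)
  then have on_line: "Im ((of_real (x * y) - \<i> * of_real y) / (d - \<i> * of_real y)) = 0"
    by (simp only: Im_complex_of_real)
  have d: "d \<in> M"
    unfolding d_def by (intro add_pt diff_pt ii_times_of_real_pt ii_pt assms)
  have "\<i> * of_real y \<noteq> d" using ne by (simp add: d_def)
  from line_meets_line[OF ii_times_of_real_pt[OF assms(2)] d zero_pt one_pt this _ on_line]
  show ?thesis using False by simp
qed (use zero_pt in simp)

text \<open>The line through \<open>\<i>\<close> parallel to the line through \<open>\<i> x\<close> and \<open>1\<close> meets the real axis in \<open>1 / x\<close>.\<close>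

lemma inverse_of_real_pt:
  assumes "of_real x \<in> M" "x \<noteq> 0"
  shows "of_real (inverse x) \<in> M"
proof -
  define d where "d = \<i> + (1 - \<i> * of_real x)"
  have "of_real (inverse x) - \<i> = of_real (inverse x) * (1 - \<i> * of_real x)"
    using assms(2) by (simp add: complex_eq_iff power2_eq_square)
  moreover have ne: "1 - \<i> * of_real x \<noteq> 0" by (simp add: complex_eq_iff)
  ultimately have "(of_real (inverse x) - \<i>) / (d - \<i>) = of_real (inverse x)"
    by (simp add: d_def)
  then have on_line: "Im ((of_real (inverse x) - \<i>) / (d - \<i>)) = 0"
    by (simp only: Im_complex_of_real)
  have d: "d \<in> M"
    unfolding d_def by (intro add_pt diff_pt ii_times_of_real_pt ii_pt one_pt assms)
  have "\<i> \<noteq> d" using ne by (simp add: d_def)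
  from line_meets_line[OF ii_pt d zero_pt one_pt this _ on_line] show ?thesis by simp
qed

text \<open>The circle with diameter from \<open>-1\<close> to \<open>x\<close> meets the imaginary axis at height \<open>sqrt x\<close>, the geometric
mean of \<open>1\<close> and \<open>x\<close>.\<close>

lemma sqrt_pt:
  assumes "of_real x \<in> M" "x \<ge> 0"
  shows "of_real (sqrt x) \<in> M"
proof (cases "x = 0")
  case False
  then have x: "x > 0" using assms by simp
  define c where "c = (of_real x + - 1) / (2 :: complex)"
  have c: "c \<in> M" unfolding c_def by (intro midpoint_pt minus_pt one_pt assms)
  have c': "c = of_real ((x - 1) / 2)" by (simp add: c_def)
  have "(norm (\<i> * of_real (sqrt x) - c))\<^sup>2 = (norm (of_real x - c))\<^sup>2"
    unfolding c' cmod_power2 using x by (simp add: power2_eq_square field_simps)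
  then have "norm (\<i> * of_real (sqrt x) - c) = norm (of_real x - c)"
    by (simp only: power2_eq_iff_nonneg norm_ge_zero)
  moreover have "c \<noteq> of_real x"
    unfolding c' of_real_eq_iff using x by (simp add: field_simps)
  moreover have "Im ((\<i> * of_real (sqrt x) - 0) / (\<i> - 0)) = 0"
    "Im ((of_real x - 0) / (\<i> - 0)) = 0 \<longleftrightarrow> norm (of_real x - c) \<noteq> norm (of_real x - c)"
    using x by (simp_all add: Im_divide)
  moreover have "0 \<noteq> \<i>" by simp
  ultimately have "\<i> * of_real (sqrt x) \<in> M"
    using line_meets_circle[OF zero_pt ii_pt c assms(1)] by blast
  then show ?thesis by (auto dest: Im_pt)
qed (use zero_pt in simp)

definition real_points :: "real set" where
  "real_points = {x. of_real x \<in> M}"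

lemma plane_over_real_points: "plane_over real_points = M"
proof (intro equalityI subsetI)
  fix z assume "z \<in> plane_over real_points"
  then have "of_real (Re z) + \<i> * of_real (Im z) \<in> M"
    by (auto simp: plane_over_def real_points_def intro: add_pt ii_times_of_real_pt)
  then show "z \<in> M" by (simp flip: complex_eq)
qed (simp add: plane_over_def real_points_def Re_pt Im_pt)

sublocale euclidean_subfield real_points
proof
  fix x y assume "x \<in> real_points" "y \<in> real_points"
  then show "x - y \<in> real_points" "x * y \<in> real_points"
    using diff_pt[of "of_real x" "of_real y"] mult_of_real_pt[of x y] by (simp_all add: real_points_def)
qed (use one_pt inverse_of_real_pt sqrt_pt in \<open>auto simp: real_points_def\<close>)

end

section \<open>Stages of the construction\<close>

lemma lines_through_mono: "P \<subseteq> Q \<Longrightarrow> lines_through P \<subseteq> lines_through Q"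
  unfolding lines_through_def
  by (intro Collect_mono impI, elim exE conjE, intro exI conjI, assumption) (erule (1) subsetD)+

lemma drawn_circles_mono: "P \<subseteq> Q \<Longrightarrow> drawn_circles P \<subseteq> drawn_circles Q"
  unfolding drawn_circles_def
  by (intro Collect_mono impI, elim exE conjE, intro exI conjI, assumption) (erule (1) subsetD)+

lemma drawn_conics_mono: "P \<subseteq> Q \<Longrightarrow> drawn_conics P \<subseteq> drawn_conics Q"
  using lines_through_mono[of P Q] unfolding drawn_conics_def by blast

lemma drawn_curves_mono:
  "\<lbrakk>F \<subseteq> G; P \<subseteq> Q\<rbrakk> \<Longrightarrow> drawn_curves F P \<subseteq> drawn_curves G Q"
  unfolding drawn_curves_def
  by (intro Un_mono Int_mono lines_through_mono drawn_circles_mono drawn_conics_mono)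

lemma stage_mono: "k \<le> n \<Longrightarrow> stage F k \<subseteq> stage F n"
  by (rule lift_Suc_mono_le) auto

lemma stage_SucI:
  assumes "A \<in> drawn_curves F (stage F k)" "B \<in> drawn_curves F (stage F k)" "A \<noteq> B"
    and "z \<in> A" "z \<in> B"
  shows "z \<in> stage F (Suc k)"
  unfolding stage.simps using assms by (intro UnI2 CollectI bexI[of _ A] bexI[of _ B] conjI IntI)

lemma stage_SucE:
  assumes "z \<in> stage F (Suc k)"
  obtains "z \<in> stage F k"
    | A B where "A \<in> drawn_curves F (stage F k)" "B \<in> drawn_curves F (stage F k)" "A \<noteq> B"
      "z \<in> A" "z \<in> B"
  using assms unfolding stage.simps by (elim UnE CollectE bexE conjE IntE)

lemma stage_mono_family:
  assumes "F \<subseteq> G"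
  shows "stage F k \<subseteq> stage G k"
proof (induction k)
  case (Suc k)
  show ?case
  proof
    fix z assume "z \<in> stage F (Suc k)"
    then show "z \<in> stage G (Suc k)"
    proof (cases rule: stage_SucE)
      case 1
      then show ?thesis using Suc stage_mono[of k "Suc k" G] by auto
    next
      case (2 A B)
      from 2(3-5) show ?thesis
        by (rule stage_SucI[OF subsetD[OF drawn_curves_mono[OF assms Suc] 2(1)]
            subsetD[OF drawn_curves_mono[OF assms Suc] 2(2)]])
    qed
  qed
qed simp

text \<open>A curve depends on finitely many points, so this transfers curves drawn from all constructible points to
a single stage.\<close>

lemma finite_subset_stage:
  assumes "finite X" and "X \<subseteq> (\<Union>k. stage F k)"
  obtains k where "X \<subseteq> stage F k"
proof -
  have "\<exists>k. X \<subseteq> stage F k" using assms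
  proof (induction X rule: finite_induct)
    case (insert x X)
    then obtain k j where "X \<subseteq> stage F k" "x \<in> stage F j" by auto
    then have "insert x X \<subseteq> stage F (max k j)"
      using stage_mono[of k "max k j" F] stage_mono[of j "max k j" F] by auto
    then show ?case by blast
  qed simp
  then show thesis using that by blast
qed

lemma stage_meet:
  assumes A: "A \<in> drawn_curves F (stage F k)" and B: "B \<in> drawn_curves F (stage F j)"
    and "A \<noteq> B" "z \<in> A" "z \<in> B"
  shows "z \<in> (\<Union>k. stage F k)"
proof -
  let ?n = "max k j"
  have "A \<in> drawn_curves F (stage F ?n)" "B \<in> drawn_curves F (stage F ?n)"
    by (rule subsetD[OF drawn_curves_mono[OF order_refl stage_mono] A], simp)
      (rule subsetD[OF drawn_curves_mono[OF order_refl stage_mono] B], simp)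
  then have "z \<in> stage F (Suc ?n)" using assms(3-5) by (rule stage_SucI)
  then show ?thesis by blast
qed

lemma line_or_circle_drawn_at_stage:
  assumes "S \<in> lines_through (\<Union>k. stage F k) \<union> drawn_circles (\<Union>k. stage F k)"
  obtains k where "S \<in> drawn_curves F (stage F k)"
proof -
  obtain a b where ab: "a \<in> (\<Union>k. stage F k)" "b \<in> (\<Union>k. stage F k)" "a \<noteq> b"
    and S: "S = affine hull {a, b} \<or> S = sphere a (dist a b)"
    using assms unfolding lines_through_def drawn_circles_def by blast
  obtain k where "{a, b} \<subseteq> stage F k"
    by (rule finite_subset_stage[of "{a, b}" F]) (use ab in auto)
  then have "S \<in> drawn_curves F (stage F k)"
    using S ab(3) unfolding drawn_curves_def lines_through_def drawn_circles_def by blast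
  then show thesis by (rule that)
qed

lemma ruler_compass_closed_stages: "ruler_compass_closed (\<Union>k. stage F k)"
proof
  have "stage F 0 \<subseteq> (\<Union>k. stage F k)" by blast
  then show "0 \<in> (\<Union>k. stage F k)" "1 \<in> (\<Union>k. stage F k)" by auto
next
  fix S T z
  assume S: "S \<in> lines_through (\<Union>k. stage F k) \<union> drawn_circles (\<Union>k. stage F k)"
    and T: "T \<in> lines_through (\<Union>k. stage F k) \<union> drawn_circles (\<Union>k. stage F k)"
    and ne: "S \<noteq> T" "z \<in> S" "z \<in> T"
  from S obtain k where "S \<in> drawn_curves F (stage F k)" by (rule line_or_circle_drawn_at_stage)
  moreover from T obtain j where "T \<in> drawn_curves F (stage F j)" by (rule line_or_circle_drawn_at_stage)
  ultimately show "z \<in> (\<Union>k. stage F k)" using ne by (rule stage_meet)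
qed

text \<open>All foci must be available at once, which is where \<open>finite_foci\<close> is needed. The length \<open>e\<close> is the distance
from \<open>0\<close> to \<open>e\<close>.\<close>

lemma conic_drawn_at_stage:
  assumes con: "conic_with C f l e" and "foci C \<subseteq> (\<Union>k. stage F k)"
    and l: "l \<in> lines_through (\<Union>k. stage F k)" and e: "of_real e \<in> (\<Union>k. stage F k)"
  obtains k where "C \<in> drawn_conics (stage F k)"
proof -
  obtain a b where ab: "a \<in> (\<Union>k. stage F k)" "b \<in> (\<Union>k. stage F k)" "a \<noteq> b" "l = affine hull {a, b}"
    using l unfolding lines_through_def by blast
  have "finite (foci C \<union> {a, b, 0, of_real e})" using finite_foci[OF con] by simp
  moreover have "foci C \<union> {a, b, 0, of_real e} \<subseteq> (\<Union>k. stage F k)"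
    using assms ab ruler_compass_closed.zero_pt[OF ruler_compass_closed_stages, of F] by blast
  ultimately obtain k where k: "foci C \<union> {a, b, 0, of_real e} \<subseteq> stage F k"
    by (rule finite_subset_stage)
  then have "l \<in> lines_through (stage F k)"
    using ab(3,4) unfolding lines_through_def by blast
  moreover have "e = dist 0 (complex_of_real e)"
    using con by (simp add: conic_with_def)
  ultimately have "C \<in> drawn_conics (stage F k)"
    using k con unfolding drawn_conics_def by blast
  then show thesis by (rule that)
qed

text \<open>A circle in the normal form of \<open>C\<close> is the preimage, under a similarity over the field, of a circle in the
plane of \<open>C\<close>. The latter is drawn through the point \<open>c + R\<close>, and a circle of radius zero contributes only
its centre.\<close>

lemma (in ruler_compass_closed) conic_circle_closed_real_points:
  assumes con: "conic_with C f l e" "f \<in> M" "l \<in> lines_through M" "of_real e \<in> M"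
    and meet: "\<And>S z. \<lbrakk>S \<in> drawn_circles M; z \<in> S; z \<in> C\<rbrakk> \<Longrightarrow> z \<in> M"
  shows "conic_circle_closed real_points (e\<^sup>2 - 1)"
proof
  have e: "e \<in> real_points" using con(4) by (simp add: real_points_def)
  then show "e\<^sup>2 - 1 \<in> real_points" by (intro mem_rules)
  show "e\<^sup>2 - 1 > -1" using con(1) by (simp add: conic_with_def)
  fix u v w y x
  assume K: "u \<in> real_points" "v \<in> real_points" "w \<in> real_points"
    and on: "y\<^sup>2 = 2 * x + (e\<^sup>2 - 1) * x\<^sup>2"
    and circle: "x\<^sup>2 + y\<^sup>2 - 2 * u * x - 2 * v * y + w = 0"
  note PM = plane_over_real_points
  obtain p m where pm: "p \<in> M" "m \<in> M" "m \<noteq> 0" and "f = p + m / of_real (1 + e)"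
    and C: "\<And>w. p + m * w \<in> C \<longleftrightarrow> w \<in> vertex_conic (e\<^sup>2 - 1)"
    by (rule conic_normal_form[OF con(1) _ _ e, unfolded PM, OF con(2,3)]) (rule that; blast)
  define q where "q = Complex x y"
  define o' where "o' = Complex u v"
  have o': "o' \<in> M" unfolding o'_def by (subst PM[symmetric]) (simp add: plane_over_def K)
  have "(norm (q - o'))\<^sup>2
      = (x\<^sup>2 + y\<^sup>2 - 2 * u * x - 2 * v * y + w) + (u\<^sup>2 + v\<^sup>2 - w)"
    by (simp add: q_def o'_def cmod_power2 power2_diff algebra_simps)
  then have "(norm (q - o'))\<^sup>2 = u\<^sup>2 + v\<^sup>2 - w" unfolding circle by simp
  moreover have "u\<^sup>2 + v\<^sup>2 - w \<in> real_points" by (intro mem_rules K)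
  ultimately have \<rho>: "norm (q - o') \<in> real_points" by (simp only: square_root_mem)
  have q: "q \<in> M"
  proof (cases "q = o'")
    case False
    define c where "c = p + m * o'"
    define R where "R = norm m * norm (q - o')"
    have c: "c \<in> M"
      unfolding c_def by (intro add_pt pm plane_over_mult[unfolded PM] o')
    have "R \<in> real_points"
      unfolding R_def by (intro mult_mem norm_mem[unfolded PM] \<rho> pm)
    then have cR: "c + of_real R \<in> M" by (intro add_pt c) (simp add: real_points_def)
    have "R > 0" using False pm by (simp add: R_def)
    then have "sphere c (dist c (c + of_real R)) \<in> drawn_circles M"
      using c cR unfolding drawn_circles_def mem_Collect_eq
      by (intro exI[of _ c] exI[of _ "c + of_real R"]) simp
    moreover have "p + m * q \<in> sphere c (dist c (c + of_real R))"
    proof -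
      have "c - (p + m * q) = m * (o' - q)" by (simp add: c_def algebra_simps)
      then have "dist c (p + m * q) = R"
        by (simp add: dist_norm R_def norm_mult norm_minus_commute)
      then show ?thesis using \<open>R > 0\<close> by (simp add: dist_norm)
    qed
    moreover have "p + m * q \<in> C" using on by (simp add: C vertex_conic_def q_def)
    ultimately have "p + m * q \<in> M" by (rule meet)
    then have "(p + m * q - p) / m \<in> M"
      by (intro plane_over_divide[unfolded PM] diff_pt pm)
    then show ?thesis using pm by simp
  qed (use o' in simp)
  then show "x \<in> real_points \<and> y \<in> real_points"
    using Re_pt[OF q] Im_pt[OF q] by (simp add: real_points_def q_def)
qed

text \<open>Induction on the stages: a new point lies on two lines or circles, or on a conic and a different
quadratic curve.\<close>

lemma (in conic_circle_closed) conic_constructible_subset: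
  assumes M: "ruler_compass_closed (plane_over K)"
  shows "conic_constructible_points \<subseteq> plane_over K"
proof -
  have "stage UNIV k \<subseteq> plane_over K" for k
  proof (induction k)
    case 0
    show ?case by (simp add: plane_over_constants)
  next
    case (Suc k)
    let ?P = "stage UNIV k"
    have conic: "\<exists>f l e. conic_with A f l e \<and> f \<in> plane_over K \<and> l \<in> lines_through (plane_over K) \<and> e \<in> K"
      if A: "A \<in> drawn_conics ?P" for A
    proof -
      obtain f l e a b where *: "foci A \<subseteq> ?P" "conic_with A f l e" "l \<in> lines_through ?P"
        "a \<in> ?P" "b \<in> ?P" "e = dist a b"
        using A unfolding drawn_conics_def by blast
      have "f \<in> foci A" unfolding foci_def using *(2) by blast
      then have f: "f \<in> plane_over K" using *(1) Suc by blast
      have l: "l \<in> lines_through (plane_over K)"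
        by (rule subsetD[OF lines_through_mono[OF Suc] *(3)])
      have "e \<in> K"
        unfolding *(6) dist_norm
        by (intro norm_mem plane_over_diff subsetD[OF Suc] *(4,5))
      with *(2) f l show ?thesis by (intro exI conjI)
    qed
    have curve: "A \<in> lines_through (plane_over K) \<union> drawn_circles (plane_over K) \<or> A \<in> drawn_conics ?P"
      if "A \<in> drawn_curves UNIV ?P" for A
      using that lines_through_mono[OF Suc] drawn_circles_mono[OF Suc]
      unfolding drawn_curves_def by blast
    have quadratic: "quadratic_curve K A" if "A \<in> drawn_curves UNIV ?P" for A
      using curve[OF that] conic[of A] quadratic_curve_line quadratic_curve_circle
        quadratic_curve_conic by blast
    have meet: "z \<in> plane_over K"
      if A: "A \<in> drawn_curves UNIV ?P" and B: "B \<in> drawn_curves UNIV ?P" and z: "A \<noteq> B" "z \<in> A" "z \<in> B"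
      for A B z
    proof -
      consider "A \<in> drawn_conics ?P" | "B \<in> drawn_conics ?P"
        | "A \<in> lines_through (plane_over K) \<union> drawn_circles (plane_over K)"
          "B \<in> lines_through (plane_over K) \<union> drawn_circles (plane_over K)"
        using curve[OF A] curve[OF B] by blast
      then show ?thesis
      proof cases
        case 1
        then show ?thesis
          using conic conic_meets_quadratic_curve[OF _ _ _ _ quadratic[OF B] z] by blast
      next
        case 2
        then show ?thesis
          using conic conic_meets_quadratic_curve[OF _ _ _ _ quadratic[OF A] z(1)[symmetric] z(3,2)] by blast
      next
        case 3
        then show ?thesis using z by (rule ruler_compass_closed.meet_pt[OF M])
      qed
    qed
    show ?case
    proof
      fix z assume "z \<in> stage UNIV (Suc k)"
      then show "z \<in> plane_over K"
        by (cases rule: stage_SucE) (use Suc in blast, rule meet)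
    qed
  qed
  then show ?thesis unfolding conic_constructible_points_def by blast
qed

theorem theorem4:
  fixes C :: "complex set"
  assumes "conic_in constructible_numbers C"
    and "\<not> (\<exists>c r. C = sphere c r)"
  shows "\<forall>z \<in> conic_constructible_points. z \<in> C_constructible_points C"
proof -
  define M where "M = C_constructible_points C"
  have M_def': "M = (\<Union>k. stage {C} k)" by (simp add: M_def C_constructible_points_def)
  have M: "ruler_compass_closed M"
    unfolding M_def' by (rule ruler_compass_closed_stages)
  define K where "K = ruler_compass_closed.real_points M"
  have K: "x \<in> K \<longleftrightarrow> of_real x \<in> M" for x
    by (simp add: K_def ruler_compass_closed.real_points_def[OF M])
  have MK: "plane_over K = M"
    unfolding K_def by (rule ruler_compass_closed.plane_over_real_points[OF M])
  have "constructible_points \<subseteq> M"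
    unfolding constructible_points_def M_def' using stage_mono_family[of "{}" "{C}"] by blast
  then have sub_real: "constructible_numbers \<subseteq> K"
    unfolding constructible_numbers_def using ruler_compass_closed.Re_pt[OF M] by (auto simp: K)
  then have "plane_over constructible_numbers \<subseteq> plane_over K" by (auto simp: plane_over_def)
  then have sub: "plane_over constructible_numbers \<subseteq> M" unfolding MK .
  obtain f l e where foci: "foci C \<subseteq> plane_over constructible_numbers"
    and con: "conic_with C f l e" and l: "l \<in> lines_through (plane_over constructible_numbers)"
    and e: "e \<in> constructible_numbers"
    using assms(1) unfolding conic_in_def by blast
  have f': "f \<in> M" using con foci sub unfolding foci_def by blast
  have l': "l \<in> lines_through M" using l lines_through_mono[OF sub] by blast
  have e': "of_real e \<in> M" using e sub_real K by blast
  obtain k where k: "C \<in> drawn_conics (stage {C} k)"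
    by (rule conic_drawn_at_stage[OF con, of "{C}"])
      (use foci sub l' e' in \<open>auto simp flip: M_def'\<close>)
  have meet: "z \<in> M" if S: "S \<in> drawn_circles M" and z: "z \<in> S" "z \<in> C" for S z
  proof -
    have "S \<in> lines_through M \<union> drawn_circles M" using S by blast
    then obtain j where "S \<in> drawn_curves {C} (stage {C} j)"
      unfolding M_def' by (rule line_or_circle_drawn_at_stage)
    moreover have "C \<in> drawn_curves {C} (stage {C} k)" using k by (simp add: drawn_curves_def)
    \<comment> \<open>intersection points with a circle are only adjoined because \<open>C\<close> is not that circle\<close>
    moreover have "S \<noteq> C" using S assms(2) unfolding drawn_circles_def by blast
    ultimately show ?thesis unfolding M_def' using z by (rule stage_meet)
  qed
  have "conic_circle_closed K (e\<^sup>2 - 1)"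
    unfolding K_def
    by (rule ruler_compass_closed.conic_circle_closed_real_points[OF M con f' l' e' meet])
  from conic_circle_closed.conic_constructible_subset[OF this] M
  have "conic_constructible_points \<subseteq> M" unfolding MK by blast
  then show ?thesis unfolding M_def by blast
qed

end
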